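(* For the collinear critical points $l_i$ ($i=1,2,3$) of the Lagrange problem with $m_1,m_2,\epsilon\in\mathbb{R}^+$, we have $$HM^{loc}_*(l_i)=\begin{cases}\mathbb{Z}_2,& *=1,\\ \{0\},&\text{otherwise.}\end{cases}$$ For the maxima $l_i$ ($i=4,5$), we have $$HM^{loc}_*(l_i)=\begin{cases}\mathbb{Z}_2,& *=2,\\ \{0\},&\text{otherwise.}\end{cases}$$
   Context: The Lagrange problem with parameters $m_1,m_2,\epsilon\in\mathbb{R}^+$ has Hamiltonian $H(q,p)=\frac12|p|^2-U(q)$, where $U:\mathbb{R}^2\setminus\{(\pm\frac12,0)\}\to\mathbb{R}$, $$U(q)=\frac{m_1}{\sqrt{(q_1+\frac12)^2+q_2^2}}+\frac{m_2}{\sqrt{(q_1-\frac12)^2+q_2^2}}+\frac{\epsilon}{2}|q|^2 .$$ Its critical points are identified with those of the potential energy $V=-U$. The paper quotes from earlier work, for all $m_1,m_2,\epsilon\in\mathbb{R}^+$, that the problem has five critical points $l_1,\dots,l_5$: the three collinear ones $l_1,l_2,l_3$ on the $q_1$-axis, and $l_4,l_5$, which are maxima. $HM^{loc}_*(l_i)$ is the local Morse homology, with $\mathbb{Z}_2$ coefficients, of $V$ at $l_i$. Local Morse homology. Let $\tilde f:M\to\mathbb{R}$ be a smooth function on a Riemannian manifold with isolated critical point $x_0$, and let $B_r$ be the set of points at distance at most $r$ from $x_0$. Choose $\delta>0$ such that $B_{2\delta}$ is compact and $x_0$ is the unique critical point of $\tilde f$ in $B_{2\delta}$. Let $\mathcal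 F_{Morse}$ be the set of smooth $f:M\to\mathbb{R}$ with $f=\tilde f$ on $M\setminus B_\delta$ and $f|_{B_\delta}$ Morse, and let $\mathcal F^\delta_{Morse}$ be the set of those $f\in\mathcal F_{Morse}$, obtained by a small perturbation of $\tilde f$, whose gradient flow lines connecting critical points in $B_\delta$ do not leave $B_{2\delta}$. For a Riemannian metric $g$ on $B_{2\delta}$ let $\tilde{\mathcal M}(f,g;x^-,x^+)$ be the set of smooth $x:\mathbb{R}\to B_{2\delta}$ with $\partial_sx+\nabla_gf(x)=0$ and $\lim_{s\to\pm\infty}x(s)=x^\pm$, where $x^\pm$ are critical points of $f$ in $B_{2\delta}$; let $\mathcal M(f,g;x^-,x^+)$ be its quotient by time shift. $(f,g)$ is a local Morse–Smale pair if $f\in\mathcal F^\delta_{Morse}$ and $g$ is regular, i.e. the linearization $W^{1,2}\to L^2$ of $x\mapsto\partial_sx+\nabla_gf(x)$ is surjective at every element of every $\tilde{\mathcal M}(f,g;x^-,x^+)$. $CM^{loc}_k$ is the $\mathbb{Z}_2$-vector space generated by the critical points of $f$ in $B_{2\delta}$ of Morse index $k$; $\partial x^-=\sum_{\mu(x^+)=\mu(x^-)-1}\#_2\mathcal M(f,g;x^-,x^+)\,x^+$, with $\mu$ the Morse index and $\#_2$ the cardinality mod 2; $HM^{loc}_k=\ker\partial_k/\operatorname{im}\partial_{k+1}$. Up to isomorphism it is asserted not to depend on $\delta,f,g$.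
   Formalization: The formal theorem assumes the quoted fact that there are exactly five critical points (three collinear, two maxima); this fails for some positive parameters, e.g. m_1=m_2=1, ε=32, where l_4, l_5 do not exist and the collinear point 0 is a maximum with HM_2=Z_2. *)

theory Defs
  imports "HOL-Analysis.Analysis" "HOL-Algebra.Algebra" "HOL-Library.Z2"
begin

text \<open>Manifolds are open subsets \<open>M\<close> of a Euclidean space. Functions on \<open>M\<close> are total
  functions of which only the values on \<open>M\<close> matter.\<close>

fun Ck_on :: "nat \<Rightarrow> ('a::real_normed_vector) set \<Rightarrow> ('a \<Rightarrow> 'b::real_normed_vector) \<Rightarrow> bool" where
  "Ck_on 0 S f \<longleftrightarrow> continuous_on S f"
| "Ck_on (Suc k) S f \<longleftrightarrow> (\<forall>x\<in>S. f differentiable (at x)) \<and>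
     (\<forall>v. Ck_on k S (\<lambda>x. frechet_derivative f (at x) v))"

definition smooth_on :: "('a::real_normed_vector) set \<Rightarrow> ('a \<Rightarrow> 'b::real_normed_vector) \<Rightarrow> bool" where
  "smooth_on S f \<longleftrightarrow> (\<forall>k. Ck_on k S f)"

definition crit_points :: "('a::real_normed_vector) set \<Rightarrow> ('a \<Rightarrow> real) \<Rightarrow> 'a set" where
  "crit_points S f = {x \<in> S. (f has_derivative (\<lambda>v. 0)) (at x)}"

definition hessian :: "('a::real_normed_vector \<Rightarrow> real) \<Rightarrow> 'a \<Rightarrow> 'a \<Rightarrow> 'a \<Rightarrow> real" where
  "hessian f x v w = frechet_derivative (\<lambda>y. frechet_derivative f (at y) v) (at x) w"

definition nondegenerate_at :: "('a::real_normed_vector \<Rightarrow> real) \<Rightarrow> 'a \<Rightarrow> bool" where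
  "nondegenerate_at f x \<longleftrightarrow> (\<forall>v. (\<forall>w. hessian f x v w = 0) \<longrightarrow> v = 0)"

definition morse_index :: "('a::euclidean_space \<Rightarrow> real) \<Rightarrow> 'a \<Rightarrow> nat" where
  "morse_index f x =
     Max {dim W | W. subspace W \<and> (\<forall>w\<in>W. w \<noteq> 0 \<longrightarrow> hessian f x w w < 0)}"

text \<open>A smooth metric on a closed ball is one that extends smoothly to an open neighbourhood.\<close>

definition riemannian_metric_on :: "('a::euclidean_space) set \<Rightarrow> ('a \<Rightarrow> 'a \<Rightarrow> 'a \<Rightarrow> real) \<Rightarrow> bool" where
  "riemannian_metric_on B g \<longleftrightarrow> (\<exists>W. open W \<and> B \<subseteq> W \<and>
     (\<forall>v w. smooth_on W (\<lambda>x. g x v w)) \<and>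
     (\<forall>x\<in>W. bilinear (g x) \<and> (\<forall>v w. g x v w = g x w v) \<and> (\<forall>v. v \<noteq> 0 \<longrightarrow> g x v v > 0)))"

abbreviation flat_metric :: "'a::euclidean_space \<Rightarrow> 'a \<Rightarrow> 'a \<Rightarrow> real" where
  "flat_metric \<equiv> (\<lambda>x v w. v \<bullet> w)"

definition gradient :: "('a::euclidean_space \<Rightarrow> 'a \<Rightarrow> 'a \<Rightarrow> real) \<Rightarrow> ('a \<Rightarrow> real) \<Rightarrow> 'a \<Rightarrow> 'a" where
  "gradient g f x = (THE u. \<forall>v. g x u v = frechet_derivative f (at x) v)"

definition flow_lines ::
  "('a::euclidean_space) set \<Rightarrow> ('a \<Rightarrow> real) \<Rightarrow> ('a \<Rightarrow> 'a \<Rightarrow> 'a \<Rightarrow> real) \<Rightarrow> 'a \<Rightarrow> 'a \<Rightarrow> (real \<Rightarrow> 'a) set" where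
  "flow_lines S f g xm xp = {x. smooth_on UNIV x \<and> range x \<subseteq> S \<and>
     (\<forall>s. (x has_vector_derivative - gradient g f (x s)) (at s)) \<and>
     (x \<longlongrightarrow> xm) at_bot \<and> (x \<longlongrightarrow> xp) at_top}"

definition unparam_flow_lines ::
  "('a::euclidean_space) set \<Rightarrow> ('a \<Rightarrow> real) \<Rightarrow> ('a \<Rightarrow> 'a \<Rightarrow> 'a \<Rightarrow> real) \<Rightarrow> 'a \<Rightarrow> 'a \<Rightarrow> (real \<Rightarrow> 'a) set set" where
  "unparam_flow_lines S f g xm xp = flow_lines S f g xm xp //
     {(x, y). x \<in> flow_lines S f g xm xp \<and> y \<in> flow_lines S f g xm xp \<and>
              (\<exists>t. y = (\<lambda>s. x (s + t)))}"

definition L2 :: "(real \<Rightarrow> 'a::euclidean_space) set" where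
  "L2 = {u \<in> borel_measurable lborel. integrable lborel (\<lambda>s. (norm (u s))\<^sup>2)}"

definition weak_derivative :: "(real \<Rightarrow> 'a::euclidean_space) \<Rightarrow> (real \<Rightarrow> 'a) \<Rightarrow> bool" where
  "weak_derivative u u' \<longleftrightarrow>
     (\<forall>\<phi> :: real \<Rightarrow> real. smooth_on UNIV \<phi> \<and> (\<exists>R. \<forall>s. \<bar>s\<bar> > R \<longrightarrow> \<phi> s = 0) \<longrightarrow>
        (LINT s|lborel. deriv \<phi> s *\<^sub>R u s) = - (LINT s|lborel. \<phi> s *\<^sub>R u' s))"

text \<open>The linearization of \<open>x \<mapsto> x' + \<nabla>\<^sub>g f (x)\<close> at \<open>x\<close> is \<open>u \<mapsto> u' + D(\<nabla>\<^sub>g f)(x) u\<close>; its domain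
  \<open>W\<^sup>1\<^sup>,\<^sup>2\<close> consists of the \<open>u\<close> in \<open>L\<^sup>2\<close> that have a weak derivative \<open>u'\<close> in \<open>L\<^sup>2\<close>.\<close>

definition linearization_surj ::
  "('a::euclidean_space \<Rightarrow> real) \<Rightarrow> ('a \<Rightarrow> 'a \<Rightarrow> 'a \<Rightarrow> real) \<Rightarrow> (real \<Rightarrow> 'a) \<Rightarrow> bool" where
  "linearization_surj f g x \<longleftrightarrow>
     (\<forall>z\<in>L2. \<exists>u\<in>L2. \<exists>u'\<in>L2. weak_derivative u u' \<and>
        (AE s in lborel. u' s + frechet_derivative (gradient g f) (at (x s)) (u s) = z s))"

text \<open>\<open>rball M x0 r\<close> is the set \<open>B\<^sub>r\<close> for \<open>M\<close> with the flat metric. The Euclidean distance is the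
  Riemannian distance of \<open>M\<close> for a plane with finitely many points removed.\<close>

definition rball :: "('a::euclidean_space) set \<Rightarrow> 'a \<Rightarrow> real \<Rightarrow> 'a set" where
  "rball M x0 r = {x \<in> M. dist x0 x \<le> r}"

definition admissible_radius :: "('a::euclidean_space) set \<Rightarrow> ('a \<Rightarrow> real) \<Rightarrow> 'a \<Rightarrow> real \<Rightarrow> bool" where
  "admissible_radius M ft x0 \<delta> \<longleftrightarrow>
     0 < \<delta> \<and> compact (rball M x0 (2*\<delta>)) \<and> crit_points (rball M x0 (2*\<delta>)) ft = {x0}"

definition C2_close :: "real \<Rightarrow> ('a::euclidean_space) set \<Rightarrow> ('a \<Rightarrow> real) \<Rightarrow> ('a \<Rightarrow> real) \<Rightarrow> bool" where
  "C2_close \<eta> S f h \<longleftrightarrow> (\<forall>x\<in>S. \<bar>f x - h x\<bar> < \<eta> \<and>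
     (\<forall>v w. norm v \<le> 1 \<longrightarrow> norm w \<le> 1 \<longrightarrow>
        \<bar>frechet_derivative f (at x) v - frechet_derivative h (at x) v\<bar> < \<eta> \<and>
        \<bar>hessian f x v w - hessian h x v w\<bar> < \<eta>))"

definition F_Morse :: "('a::euclidean_space) set \<Rightarrow> ('a \<Rightarrow> real) \<Rightarrow> 'a \<Rightarrow> real \<Rightarrow> ('a \<Rightarrow> real) set" where
  "F_Morse M ft x0 \<delta> = {f. smooth_on M f \<and> (\<forall>x \<in> M - rball M x0 \<delta>. f x = ft x) \<and>
     (\<forall>x \<in> crit_points (rball M x0 \<delta>) f. nondegenerate_at f x)}"

text \<open>The parameter \<open>\<eta>\<close> measures how small the perturbation of \<open>ft\<close> is, in the \<open>C\<^sup>2\<close> topology.\<close>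

definition F_Morse_local ::
  "('a::euclidean_space) set \<Rightarrow> ('a \<Rightarrow> real) \<Rightarrow> 'a \<Rightarrow> real \<Rightarrow> real \<Rightarrow> ('a \<Rightarrow> real) set" where
  "F_Morse_local M ft x0 \<delta> \<eta> = {f \<in> F_Morse M ft x0 \<delta>. C2_close \<eta> (rball M x0 \<delta>) f ft \<and>
     (\<forall>xm \<in> crit_points (rball M x0 \<delta>) f. \<forall>xp \<in> crit_points (rball M x0 \<delta>) f.
        \<forall>x \<in> flow_lines M f flat_metric xm xp. range x \<subseteq> rball M x0 (2*\<delta>))}"

definition local_Morse_Smale_pair ::
  "('a::euclidean_space) set \<Rightarrow> ('a \<Rightarrow> real) \<Rightarrow> 'a \<Rightarrow> real \<Rightarrow> real
   \<Rightarrow> ('a \<Rightarrow> real) \<Rightarrow> ('a \<Rightarrow> 'a \<Rightarrow> 'a \<Rightarrow> real) \<Rightarrow> bool" where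
  "local_Morse_Smale_pair M ft x0 \<delta> \<eta> f g \<longleftrightarrow>
     f \<in> F_Morse_local M ft x0 \<delta> \<eta> \<and> riemannian_metric_on (rball M x0 (2*\<delta>)) g \<and>
     (\<forall>xm \<in> crit_points (rball M x0 (2*\<delta>)) f. \<forall>xp \<in> crit_points (rball M x0 (2*\<delta>)) f.
        \<forall>x \<in> flow_lines (rball M x0 (2*\<delta>)) f g xm xp. linearization_surj f g x)"

text \<open>In the following \<open>B\<close> stands for \<open>B\<^sub>2\<^sub>\<delta>\<close>. The vector space over \<open>\<int>\<^sub>2\<close> freely generated by the
  critical points of index \<open>k\<close> is given by its additive group; additive maps between such
  spaces are linear.\<close>

definition CM :: "('a::euclidean_space) set \<Rightarrow> ('a \<Rightarrow> real) \<Rightarrow> int \<Rightarrow> ('a \<Rightarrow> bit) monoid" where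
  "CM B f k = \<lparr>carrier = {c. finite {x. c x \<noteq> 0} \<and>
                  {x. c x \<noteq> 0} \<subseteq> {x \<in> crit_points B f. int (morse_index f x) = k}},
               mult = (\<lambda>c d x. c x + d x), one = (\<lambda>x. 0)\<rparr>"

definition boundary ::
  "('a::euclidean_space) set \<Rightarrow> ('a \<Rightarrow> real) \<Rightarrow> ('a \<Rightarrow> 'a \<Rightarrow> 'a \<Rightarrow> real) \<Rightarrow> ('a \<Rightarrow> bit) \<Rightarrow> ('a \<Rightarrow> bit)" where
  "boundary B f g c = (\<lambda>xp. \<Sum>xm | c xm \<noteq> 0 \<and>
       xp \<in> crit_points B f \<and> int (morse_index f xp) = int (morse_index f xm) - 1.
     c xm * of_nat (card (unparam_flow_lines B f g xm xp)))"

definition HM ::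
  "('a::euclidean_space) set \<Rightarrow> ('a \<Rightarrow> real) \<Rightarrow> ('a \<Rightarrow> 'a \<Rightarrow> 'a \<Rightarrow> real) \<Rightarrow> int \<Rightarrow> ('a \<Rightarrow> bit) set monoid" where
  "HM B f g k =
     (CM B f k)\<lparr>carrier := kernel (CM B f k) (CM B f (k - 1)) (boundary B f g)\<rparr>
       Mod (boundary B f g ` carrier (CM B f (k + 1)))"

text \<open>\<open>HM\<^sup>l\<^sup>o\<^sup>c\<close> is defined up to isomorphism by means of auxiliary choices. It is \<open>H\<close> if choices
  exist and, for every admissible \<open>\<delta>\<close>, all sufficiently small perturbations \<open>f\<close> and all
  regular metrics \<open>g\<close> for \<open>f\<close> lead to \<open>H\<close>.\<close>

definition has_local_Morse_homology ::
  "('a::euclidean_space) set \<Rightarrow> ('a \<Rightarrow> real) \<Rightarrow> 'a \<Rightarrow> (int \<Rightarrow> 'b monoid) \<Rightarrow> bool" where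
  "has_local_Morse_homology M ft x0 H \<longleftrightarrow>
     (\<exists>\<delta>. admissible_radius M ft x0 \<delta>) \<and>
     (\<forall>\<delta>. admissible_radius M ft x0 \<delta> \<longrightarrow>
        (\<forall>\<eta>>0. \<exists>f g. local_Morse_Smale_pair M ft x0 \<delta> \<eta> f g) \<and>
        (\<exists>\<eta>>0. \<forall>f g. local_Morse_Smale_pair M ft x0 \<delta> \<eta> f g \<longrightarrow>
           (\<forall>k. HM (rball M x0 (2*\<delta>)) f g k \<cong> H k)))"

definition lagrange_domain :: "(real^2) set" where
  "lagrange_domain = UNIV - {vector [1/2, 0], vector [-1/2, 0]}"

definition lagrange_U :: "real \<Rightarrow> real \<Rightarrow> real \<Rightarrow> real^2 \<Rightarrow> real" where
  "lagrange_U m1 m2 \<epsilon> q =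
     m1 / sqrt ((q$1 + 1/2)\<^sup>2 + (q$2)\<^sup>2) + m2 / sqrt ((q$1 - 1/2)\<^sup>2 + (q$2)\<^sup>2) + \<epsilon>/2 * (norm q)\<^sup>2"

definition lagrange_V :: "real \<Rightarrow> real \<Rightarrow> real \<Rightarrow> real^2 \<Rightarrow> real" where
  "lagrange_V m1 m2 \<epsilon> q = - lagrange_U m1 m2 \<epsilon> q"

text \<open>The critical points \<open>l 1, \<dots>, l 5\<close>. Five critical points do not exist for all positive
  parameters: the distances \<open>r1, r2\<close> of a critical point off the axis from the two singular
  points satisfy \<open>r1^3 = 2 * m1 / \<epsilon>\<close> and \<open>r2^3 = 2 * m2 / \<epsilon>\<close>, so such points exist iff
  \<open>\<bar>r1 - r2\<bar> < 1 < r1 + r2\<close> for these values. Otherwise one of the three collinear critical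
  points is a maximum of \<open>V\<close>, possibly a degenerate one.\<close>

definition lagrange_points :: "real \<Rightarrow> real \<Rightarrow> real \<Rightarrow> (nat \<Rightarrow> real^2) \<Rightarrow> bool" where
  "lagrange_points m1 m2 \<epsilon> l \<longleftrightarrow>
     inj_on l {1..5} \<and> l ` {1..5} = crit_points lagrange_domain (lagrange_V m1 m2 \<epsilon>) \<and>
     (\<forall>i\<in>{1..3}. l i $ 2 = 0) \<and>
     (\<forall>i\<in>{4..5}. \<forall>\<^sub>F q in at (l i). lagrange_V m1 m2 \<epsilon> q \<le> lagrange_V m1 m2 \<epsilon> (l i))"

end

theory Submission
  imports Defs "HOL-Probability.Distributions"
begin

text \<open>At an equilibrium off the axis the distances \<open>\<rho>1, \<rho>2\<close> from the poles satisfy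
  \<open>\<rho>i^3 = 2 * mi / \<epsilon>\<close>, and the Hessian of \<open>V\<close> is negative definite. Each of the three intervals of the
  axis contains at most one equilibrium, since the force is monotone there; hence \<open>l 4, l 5\<close> are off the
  axis. The triangle inequality for \<open>\<rho>1, \<rho>2\<close>, which expresses their existence, makes every collinear
  equilibrium a nondegenerate saddle. So all five critical points are nondegenerate.

  Near a nondegenerate critical point a \<open>C\<^sup>2\<close>-small perturbation has a single critical point, of
  the same index, so the complex has one generator and no differential. A local Morse--Smale pair is the
  unperturbed function with a constant metric: the only flow line is constant, and for a metric
  adapted to the Hessian the linearization there is \<open>u' + L u\<close> with an involution \<open>L\<close>, which is
  inverted on \<open>L\<^sup>2\<close> by convolution with one-sided exponentials.\<close>

section \<open>Solving the linearized equation in L2\<close>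

text \<open>The exponential rates of the linearized flow are the eigenvalues of the Hessian relative
  to the metric. A regular metric may be chosen freely, so the absolute values of these eigenvalues
  are put into \<open>G\<close> and only the rates 1 and -1 remain. A single probability density,
  the exponential one of rate 1, then serves both signs, looking backwards or forwards in time, and
  convolution with a probability measure is bounded on L2 by Jensen's inequality. The radius
  \<delta> need not be small: the definition of the homology quantifies over every \<delta> for
  which the ball of radius 2\<delta> contains no other critical point. Newton's method controls a
  perturbation only near the critical point. On the rest of the ball of radius \<delta>, compactness
  bounds the first derivative of the unperturbed function away from zero, and farther out the
  perturbation is absent.\<close>

lemma L2_iff: "u \<in> L2 \<longleftrightarrow> u \<in> borel_measurable borel \<and> integrable lborel (\<lambda>s. (norm (u s))\<^sup>2)"
  by (simp add: L2_def)

lemma L2_bounded_linear: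
  assumes u: "u \<in> L2" and T: "bounded_linear T"
  shows "(\<lambda>s. T (u s)) \<in> L2"
proof -
  obtain K where K: "\<And>x. norm (T x) \<le> norm x * K"
    using bounded_linear.bounded[OF T] by auto
  have m: "(\<lambda>s. T (u s)) \<in> borel_measurable borel"
    using u T by (auto simp: L2_iff intro: borel_measurable_continuous_onI linear_continuous_on
      intro!: measurable_compose[of u borel borel T])
  have "integrable lborel (\<lambda>s. (norm (T (u s)))\<^sup>2)"
  proof (rule Bochner_Integration.integrable_bound)
    show "integrable lborel (\<lambda>s. K\<^sup>2 * (norm (u s))\<^sup>2)" using u by (auto simp: L2_iff)
    show "AE s in lborel. norm ((norm (T (u s)))\<^sup>2) \<le> norm (K\<^sup>2 * (norm (u s))\<^sup>2)"
      using power_mono[OF K norm_ge_zero, of _ 2] by (auto simp: power_mult_distrib mult.commute)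
  qed (use m in measurable)
  with m show ?thesis by (simp add: L2_iff)
qed

lemma power2_norm_add_le:
  fixes x y :: "'a::real_normed_vector"
  shows "(norm (x + y))\<^sup>2 \<le> 2 * (norm x)\<^sup>2 + 2 * (norm y)\<^sup>2"
proof -
  have "(norm (x + y))\<^sup>2 \<le> (norm x + norm y)\<^sup>2" by (intro power_mono norm_triangle_ineq) auto
  also have "\<dots> \<le> 2 * (norm x)\<^sup>2 + 2 * (norm y)\<^sup>2"
    using sum_squares_bound[of "norm x" "norm y"] by (simp add: power2_sum)
  finally show ?thesis .
qed

lemma L2_add:
  assumes u: "u \<in> L2" and v: "v \<in> L2"
  shows "(\<lambda>s. u s + v s) \<in> L2"
proof -
  have m: "(\<lambda>s. u s + v s) \<in> borel_measurable borel" using u v by (auto simp: L2_iff)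
  have "integrable lborel (\<lambda>s. (norm (u s + v s))\<^sup>2)"
  proof (rule Bochner_Integration.integrable_bound)
    show "integrable lborel (\<lambda>s. 2 * (norm (u s))\<^sup>2 + 2 * (norm (v s))\<^sup>2)"
      using u v by (auto simp: L2_iff)
    show "AE s in lborel. norm ((norm (u s + v s))\<^sup>2) \<le> norm (2 * (norm (u s))\<^sup>2 + 2 * (norm (v s))\<^sup>2)"
      using power2_norm_add_le by auto
  qed (use m in measurable)
  with m show ?thesis by (simp add: L2_iff)
qed

lemma L2_diff: "u \<in> L2 \<Longrightarrow> v \<in> L2 \<Longrightarrow> (\<lambda>s. u s - v s) \<in> L2"
  using L2_add[of u "\<lambda>s. - v s"] L2_bounded_linear[of v uminus] bounded_linear_minus[OF bounded_linear_ident]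
  by auto

text \<open>On a probability space constants are integrable, so this bound turns
  square-integrability into integrability.\<close>

lemma abs_le_one_plus_square: "\<bar>x\<bar> \<le> 1 + x\<^sup>2" for x :: real
  using sum_squares_bound[of 1 "\<bar>x\<bar>"] by (simp add: power2_eq_square)

lemma L2_integrable_scaleR:
  fixes u :: "real \<Rightarrow> 'a::euclidean_space"
  assumes k: "k \<in> L2" and u: "u \<in> L2"
  shows "integrable lborel (\<lambda>s. k s *\<^sub>R u s)"
proof (rule Bochner_Integration.integrable_bound)
  show "integrable lborel (\<lambda>s. (norm (k s))\<^sup>2 + (norm (u s))\<^sup>2)" using k u by (auto simp: L2_iff)
  show "AE s in lborel. norm (k s *\<^sub>R u s) \<le> norm ((norm (k s))\<^sup>2 + (norm (u s))\<^sup>2)"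
  proof (intro AE_I2)
    fix s
    show "norm (k s *\<^sub>R u s) \<le> norm ((norm (k s))\<^sup>2 + (norm (u s))\<^sup>2)"
      using sum_squares_bound[of "norm (k s)" "norm (u s)"] mult_nonneg_nonneg[of "norm (k s)" "norm (u s)"]
      unfolding norm_scaleR by (simp del: power2_norm_eq_inner mult_nonneg_nonneg)
  qed
qed (use k u in \<open>auto simp: L2_iff\<close>)

text \<open>Translation invariance makes the inner integral independent of \<open>t\<close>, and a
  probability measure integrates constants. This provides the joint integrability for the later
  exchanges of integrals; the value \<open>c = 0\<close> covers the untranslated factor.\<close>

lemma L2_translates_integrable:
  fixes w :: "real \<Rightarrow> 'a::euclidean_space"
  assumes \<mu>: "prob_space \<mu>" "sets \<mu> = sets borel" and w: "w \<in> L2"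
  shows "integrable (\<mu> \<Otimes>\<^sub>M lborel) (\<lambda>(t, s). (norm (w (s + c * t)))\<^sup>2)"
proof -
  interpret prob_space \<mu> by fact
  interpret pair_sigma_finite \<mu> "lborel :: real measure" ..
  note [measurable_cong] = \<mu>(2)
  have [measurable]: "w \<in> borel_measurable borel" using w by (simp add: L2_iff)
  have shift: "integrable lborel (\<lambda>s. (norm (w (s + c * t)))\<^sup>2)"
    "(\<integral>s. (norm (w (s + c * t)))\<^sup>2 \<partial>lborel) = (\<integral>s. (norm (w s))\<^sup>2 \<partial>lborel)" for t
    using w lborel_integrable_real_affine[of "\<lambda>s. (norm (w s))\<^sup>2" 1 "c * t"]
      lborel_integral_real_affine[of 1 "\<lambda>s. (norm (w s))\<^sup>2" "c * t"]
    by (auto simp: L2_iff add.commute)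
  show ?thesis
  proof (rule Fubini_integrable)
    show "(\<lambda>(t, s). (norm (w (s + c * t)))\<^sup>2) \<in> borel_measurable (\<mu> \<Otimes>\<^sub>M lborel)" by measurable
    show "integrable \<mu> (\<lambda>x. \<integral>y. norm (case (x, y) of (t, s) \<Rightarrow> (norm (w (s + c * t)))\<^sup>2) \<partial>lborel)"
      by (simp add: shift)
    show "AE x in \<mu>. integrable lborel (\<lambda>y. case (x, y) of (t, s) \<Rightarrow> (norm (w (s + c * t)))\<^sup>2)"
      by (simp add: shift)
  qed
qed

text \<open>An average of \<open>z\<close> over the past for \<open>c = 1\<close> and over the
  future for \<open>c = -1\<close>, when \<open>\<mu>\<close> lives on the positive half-line. For
  the exponential density, \<open>a = convolve \<mu> c z\<close> is the L2 solution of
  \<open>c a' + a = z\<close>.\<close>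

definition convolve :: "real measure \<Rightarrow> real \<Rightarrow> (real \<Rightarrow> 'a::euclidean_space) \<Rightarrow> real \<Rightarrow> 'a" where
  "convolve \<mu> c z s = (\<integral>t. z (s - c * t) \<partial>\<mu>)"

lemma convolve_L2:
  fixes z :: "real \<Rightarrow> 'a::euclidean_space"
  assumes \<mu>: "prob_space \<mu>" "sets \<mu> = sets borel" and z: "z \<in> L2"
  shows "convolve \<mu> c z \<in> L2"
proof -
  interpret prob_space \<mu> by fact
  interpret pair_sigma_finite \<mu> "lborel :: real measure" ..
  note [measurable_cong] = \<mu>(2)
  have [measurable]: "z \<in> borel_measurable borel" using z by (simp add: L2_iff)
  have I: "integrable (\<mu> \<Otimes>\<^sub>M lborel) (\<lambda>(t, s). (norm (z (s - c * t)))\<^sup>2)"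
    using L2_translates_integrable[OF \<mu> z, of "-c"] by simp
  have m: "convolve \<mu> c z \<in> borel_measurable borel"
    unfolding convolve_def by measurable
  have "integrable lborel (\<lambda>s. (norm (convolve \<mu> c z s))\<^sup>2)"
  proof (rule Bochner_Integration.integrable_bound)
    show "integrable lborel (\<lambda>s. \<integral>t. (norm (z (s - c * t)))\<^sup>2 \<partial>\<mu>)"
      using integrable_snd[OF I] by simp
    show "AE s in lborel. norm ((norm (convolve \<mu> c z s))\<^sup>2) \<le> norm (\<integral>t. (norm (z (s - c * t)))\<^sup>2 \<partial>\<mu>)"
      using AE_integrable_snd[OF I]
    proof (rule AE_mp, intro AE_I2 impI)
      fix s assume sq: "integrable \<mu> (\<lambda>t. (norm (z (s - c * t)))\<^sup>2)"
      define h where "h t = norm (z (s - c * t))" for t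
      have sq: "integrable \<mu> (\<lambda>t. (h t)\<^sup>2)" using sq by (simp add: h_def)
      have h: "integrable \<mu> h"
      proof (rule Bochner_Integration.integrable_bound)
        show "integrable \<mu> (\<lambda>t. 1 + (h t)\<^sup>2)" using sq by auto
        show "AE t in \<mu>. norm (h t) \<le> norm (1 + (h t)\<^sup>2)" using abs_le_one_plus_square by auto
      qed (unfold h_def, measurable)
      \<comment> \<open>Jensen's inequality for the square, in the form that a variance is
        nonnegative.\<close>
      have "0 \<le> (\<integral>t. (h t - expectation h)\<^sup>2 \<partial>\<mu>)" by simp
      also have "\<dots> = (\<integral>t. (h t)\<^sup>2 \<partial>\<mu>) - (expectation h)\<^sup>2" by (rule variance_eq[OF h sq])
      finally have "(expectation h)\<^sup>2 \<le> (\<integral>t. (h t)\<^sup>2 \<partial>\<mu>)" by simp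
      moreover have "norm (convolve \<mu> c z s) \<le> expectation h"
        unfolding convolve_def h_def by (rule integral_norm_bound)
      from power_mono[OF this, of 2] have "(norm (convolve \<mu> c z s))\<^sup>2 \<le> (expectation h)\<^sup>2" by simp
      ultimately show "norm ((norm (convolve \<mu> c z s))\<^sup>2) \<le> norm (\<integral>t. (norm (z (s - c * t)))\<^sup>2 \<partial>\<mu>)"
        unfolding h_def by (simp only: real_norm_def abs_of_nonneg[OF zero_le_power2] abs_of_nonneg[OF integral_nonneg])
    qed
  qed (use m in measurable)
  with m show ?thesis by (simp add: L2_iff)
qed

text \<open>The adjoint of averaging in one direction is averaging in the other: exchange the
  integrals and substitute \<open>s + c * t\<close> for \<open>s\<close>. This moves the convolution
  from \<open>z\<close>, which is merely in L2, onto a smooth test function.\<close>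

lemma integral_scaleR_convolve:
  fixes z :: "real \<Rightarrow> 'a::euclidean_space"
  assumes \<mu>: "prob_space \<mu>" "sets \<mu> = sets borel" and z: "z \<in> L2" and k: "k \<in> L2"
  shows "(\<integral>s. k s *\<^sub>R convolve \<mu> c z s \<partial>lborel) = (\<integral>s. convolve \<mu> (-c) k s *\<^sub>R z s \<partial>lborel)"
proof -
  interpret prob_space \<mu> by fact
  interpret pair_sigma_finite \<mu> "lborel :: real measure" ..
  note [measurable_cong] = \<mu>(2)
  have [measurable]: "z \<in> borel_measurable borel" "k \<in> borel_measurable borel" using z k by (auto simp: L2_iff)
  have bd: "norm (k a *\<^sub>R z b) \<le> norm ((norm (k a))\<^sup>2 + (norm (z b))\<^sup>2)" for a b
    using sum_squares_bound[of "norm (k a)" "norm (z b)"] mult_nonneg_nonneg[of "norm (k a)" "norm (z b)"]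
    unfolding norm_scaleR by (simp del: power2_norm_eq_inner mult_nonneg_nonneg)
  have I1: "integrable (\<mu> \<Otimes>\<^sub>M lborel) (\<lambda>(t, s). k s *\<^sub>R z (s - c * t))"
  proof (rule Bochner_Integration.integrable_bound)
    show "integrable (\<mu> \<Otimes>\<^sub>M lborel) (\<lambda>(t, s). (norm (k s))\<^sup>2 + (norm (z (s - c * t)))\<^sup>2)"
      using Bochner_Integration.integrable_add[OF L2_translates_integrable[OF \<mu> k, of 0] L2_translates_integrable[OF \<mu> z, of "-c"]]
      by (simp add: case_prod_unfold)
    show "AE x in \<mu> \<Otimes>\<^sub>M lborel. norm (case x of (t, s) \<Rightarrow> k s *\<^sub>R z (s - c * t))
        \<le> norm (case x of (t, s) \<Rightarrow> (norm (k s))\<^sup>2 + (norm (z (s - c * t)))\<^sup>2)"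
      using bd by (intro AE_I2) (simp add: case_prod_unfold)
  qed measurable
  have I2: "integrable (\<mu> \<Otimes>\<^sub>M lborel) (\<lambda>(t, s). k (s + c * t) *\<^sub>R z s)"
  proof (rule Bochner_Integration.integrable_bound)
    show "integrable (\<mu> \<Otimes>\<^sub>M lborel) (\<lambda>(t, s). (norm (k (s + c * t)))\<^sup>2 + (norm (z s))\<^sup>2)"
      using Bochner_Integration.integrable_add[OF L2_translates_integrable[OF \<mu> k, of c] L2_translates_integrable[OF \<mu> z, of 0]]
      by (simp add: case_prod_unfold)
    show "AE x in \<mu> \<Otimes>\<^sub>M lborel. norm (case x of (t, s) \<Rightarrow> k (s + c * t) *\<^sub>R z s)
        \<le> norm (case x of (t, s) \<Rightarrow> (norm (k (s + c * t)))\<^sup>2 + (norm (z s))\<^sup>2)"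
      using bd by (intro AE_I2) (simp add: case_prod_unfold)
  qed measurable
  have AEsq: "AE s in lborel. integrable \<mu> (\<lambda>t. (norm (k (s + c * t)))\<^sup>2)"
    using AE_integrable_snd[OF L2_translates_integrable[OF \<mu> k, of c]] by simp
  \<comment> \<open>Pulling the factor \<open>z s\<close> out of the integral over \<open>t\<close>
    requires the translates of \<open>k\<close> to be integrable, which Fubini gives for almost
    every \<open>s\<close>.\<close>
  have AEi: "AE s in lborel. integrable \<mu> (\<lambda>t. k (s + c * t))"
    using AEsq
  proof (rule AE_mp, intro AE_I2 impI)
    fix s assume sq: "integrable \<mu> (\<lambda>t. (norm (k (s + c * t)))\<^sup>2)"
    show "integrable \<mu> (\<lambda>t. k (s + c * t))"
    proof (rule Bochner_Integration.integrable_bound)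
      show "integrable \<mu> (\<lambda>t. 1 + (norm (k (s + c * t)))\<^sup>2)" using sq by auto
      show "AE t in \<mu>. norm (k (s + c * t)) \<le> norm (1 + (norm (k (s + c * t)))\<^sup>2)"
        using abs_le_one_plus_square by auto
    qed measurable
  qed
  have "(\<integral>s. k s *\<^sub>R convolve \<mu> c z s \<partial>lborel) = (\<integral>s. (\<integral>t. k s *\<^sub>R z (s - c * t) \<partial>\<mu>) \<partial>lborel)"
    by (simp add: convolve_def)
  also have "\<dots> = (\<integral>t. (\<integral>s. k s *\<^sub>R z (s - c * t) \<partial>lborel) \<partial>\<mu>)"
    by (rule Fubini_integral[OF I1])
  also have "\<dots> = (\<integral>t. (\<integral>s. k (s + c * t) *\<^sub>R z s \<partial>lborel) \<partial>\<mu>)"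
    using lborel_integral_real_affine[of 1 "\<lambda>s. k s *\<^sub>R z (s - c * t)" "c * t" for t]
    by (simp add: add.commute)
  also have "\<dots> = (\<integral>s. (\<integral>t. k (s + c * t) *\<^sub>R z s \<partial>\<mu>) \<partial>lborel)"
    by (rule Fubini_integral[OF I2, symmetric])
  also have "\<dots> = (\<integral>s. convolve \<mu> (-c) k s *\<^sub>R z s \<partial>lborel)"
  proof (rule integral_cong_AE)
    show "AE s in lborel. (\<integral>t. k (s + c * t) *\<^sub>R z s \<partial>\<mu>) = convolve \<mu> (-c) k s *\<^sub>R z s"
      using AEi by (rule AE_mp) (simp add: convolve_def)
  qed (unfold convolve_def, measurable)
  finally show ?thesis .
qed

section \<open>Exponential kernels and the two scalar equations\<close>

lemma compact_support_L2:
  fixes \<phi> :: "real \<Rightarrow> real"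
  assumes "continuous_on UNIV \<phi>" and "\<And>s. \<bar>s\<bar> > R \<Longrightarrow> \<phi> s = 0"
  shows "\<phi> \<in> L2"
proof -
  have "integrable lborel (\<lambda>s. indicator {-R..R} s *\<^sub>R (\<phi> s)\<^sup>2)"
    using assms(1) by (intro borel_integrable_compact) (auto intro!: continuous_intros intro: continuous_on_subset)
  moreover have "(\<lambda>s. indicator {-R..R} s *\<^sub>R (\<phi> s)\<^sup>2) = (\<lambda>s. (\<phi> s)\<^sup>2)"
    using assms(2) by (force simp: indicator_def fun_eq_iff)
  ultimately show ?thesis using assms(1) by (auto simp: L2_iff borel_measurable_continuous_onI)
qed

text \<open>Integration by parts in \<open>t\<close>: the density is minus its own derivative on the
  half-line, and its jump at 0 contributes the term \<open>\<phi> s\<close>.\<close>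

lemma convolve_exponential_deriv:
  fixes \<phi> :: "real \<Rightarrow> real"
  defines "\<mu> \<equiv> density lborel (exponential_density 1)"
  assumes c: "\<bar>c\<bar> = 1" and \<phi>: "\<And>s. (\<phi> has_real_derivative \<phi>' s) (at s)" "continuous_on UNIV \<phi>'"
    and R: "\<And>s. \<bar>s\<bar> > R \<Longrightarrow> \<phi> s = 0" "\<And>s. \<bar>s\<bar> > R \<Longrightarrow> \<phi>' s = 0"
  shows "convolve \<mu> c \<phi>' s = c * (\<phi> s - convolve \<mu> c \<phi> s)"
proof -
  \<comment> \<open>Beyond this time \<open>s - c * t\<close> has left the support of \<phi>, so the
    integrals run over a compact interval and the boundary term at \<open>N\<close>
    vanishes.\<close>
  define N where "N = \<bar>R\<bar> + \<bar>s\<bar> + 1"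
  have c1: "c = 1 \<or> c = -1" using c by linarith
  then have c2: "c * c = 1" by auto
  have far: "\<bar>s - c * t\<bar> > R" if "t \<ge> N" for t
    using that c1 unfolding N_def by (elim disjE; simp; linarith)
  have cont: "continuous_on UNIV \<phi>" using \<phi>(1) DERIV_isCont continuous_at_imp_continuous_on by blast
  have conv: "convolve \<mu> c g s = (\<integral>t. indicator {0..N} t *\<^sub>R (exp (-t) * g (s - c * t)) \<partial>lborel)"
    "integrable lborel (\<lambda>t. indicator {0..N} t *\<^sub>R (exp (-t) * g (s - c * t)))"
    if g: "continuous_on UNIV g" "\<And>s. \<bar>s\<bar> > R \<Longrightarrow> g s = 0" for g :: "real \<Rightarrow> real"
  proof -
    have gm: "g \<in> borel_measurable borel" using g(1) by (rule borel_measurable_continuous_onI)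
    have "convolve \<mu> c g s = (\<integral>t. exponential_density 1 t *\<^sub>R g (s - c * t) \<partial>lborel)"
      unfolding convolve_def \<mu>_def using gm by (intro integral_density) (auto simp: exponential_density_nonneg)
    also have "\<dots> = (\<integral>t. indicator {0..N} t *\<^sub>R (exp (-t) * g (s - c * t)) \<partial>lborel)"
    proof (intro Bochner_Integration.integral_cong refl)
      fix t
      show "exponential_density 1 t *\<^sub>R g (s - c * t) = indicator {0..N} t *\<^sub>R (exp (-t) * g (s - c * t))"
        using g(2)[OF far, of t] by (cases "t < 0"; cases "t \<ge> N") (auto simp: exponential_density_def)
    qed
    finally show "convolve \<mu> c g s = (\<integral>t. indicator {0..N} t *\<^sub>R (exp (-t) * g (s - c * t)) \<partial>lborel)" .
    show "integrable lborel (\<lambda>t. indicator {0..N} t *\<^sub>R (exp (-t) * g (s - c * t)))"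
      by (intro borel_integrable_compact continuous_intros continuous_on_compose2[OF g(1)]) auto
  qed
  have "(\<integral>t. indicator {0..N} t *\<^sub>R (- c * (exp (-t) * \<phi>' (s - c * t)) - exp (-t) * \<phi> (s - c * t)) \<partial>lborel)
      = exp (-N) * \<phi> (s - c * N) - exp (-0) * \<phi> (s - c * 0)"
  proof (rule integral_FTC_Icc)
    show "0 \<le> N" by (simp add: N_def)
    show "continuous_on {0..N} (\<lambda>t. - c * (exp (-t) * \<phi>' (s - c * t)) - exp (-t) * \<phi> (s - c * t))"
      by (intro continuous_intros continuous_on_compose2[OF \<phi>(2)] continuous_on_compose2[OF cont]) auto
    fix t
    have "((\<lambda>t. exp (-t) * \<phi> (s - c * t)) has_real_derivative
       - c * (exp (-t) * \<phi>' (s - c * t)) - exp (-t) * \<phi> (s - c * t)) (at t)"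
      by (rule DERIV_cong[OF DERIV_mult[OF DERIV_fun_exp[OF DERIV_minus[OF DERIV_ident]]
          DERIV_chain2[OF \<phi>(1) DERIV_diff[OF DERIV_const DERIV_cmult[OF DERIV_ident]]]]])
        (simp add: algebra_simps)
    then show "((\<lambda>t. exp (-t) * \<phi> (s - c * t)) has_vector_derivative
       - c * (exp (-t) * \<phi>' (s - c * t)) - exp (-t) * \<phi> (s - c * t)) (at t within {0..N})"
      by (simp add: has_real_derivative_iff_has_vector_derivative has_vector_derivative_at_within)
  qed
  moreover have "(\<integral>t. indicator {0..N} t *\<^sub>R (- c * (exp (-t) * \<phi>' (s - c * t)) - exp (-t) * \<phi> (s - c * t)) \<partial>lborel)
     = - c * convolve \<mu> c \<phi>' s - convolve \<mu> c \<phi> s"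
  proof -
    let ?p = "\<lambda>t. indicator {0..N} t *\<^sub>R (exp (-t) * \<phi>' (s - c * t))"
    let ?q = "\<lambda>t. indicator {0..N} t *\<^sub>R (exp (-t) * \<phi> (s - c * t))"
    have "(\<integral>t. indicator {0..N} t *\<^sub>R (- c * (exp (-t) * \<phi>' (s - c * t)) - exp (-t) * \<phi> (s - c * t)) \<partial>lborel)
      = (\<integral>t. - c * ?p t - ?q t \<partial>lborel)"
      by (intro Bochner_Integration.integral_cong refl) (simp add: right_diff_distrib)
    also have "\<dots> = - c * (\<integral>t. ?p t \<partial>lborel) - (\<integral>t. ?q t \<partial>lborel)"
      using conv(2)[OF \<phi>(2) R(2)] conv(2)[OF cont R(1)]
      by (subst Bochner_Integration.integral_diff) auto
    finally show ?thesis by (simp only: conv(1)[OF \<phi>(2) R(2)] conv(1)[OF cont R(1)])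
  qed
  ultimately have "- c * convolve \<mu> c \<phi>' s - convolve \<mu> c \<phi> s = - \<phi> s"
    using R(1)[OF far, of N] by simp
  with c1 show ?thesis by (elim disjE) simp_all
qed

lemma test_functionE:
  fixes \<phi> :: "real \<Rightarrow> real"
  assumes "smooth_on UNIV \<phi>" "\<And>s. \<bar>s\<bar> > R \<Longrightarrow> \<phi> s = 0"
  shows "(\<phi> has_real_derivative deriv \<phi> s) (at s)" "continuous_on UNIV (deriv \<phi>)"
    "\<And>s. \<bar>s\<bar> > R \<Longrightarrow> deriv \<phi> s = 0" "\<phi> \<in> L2" "deriv \<phi> \<in> L2"
proof -
  have C1: "Ck_on (Suc 0) UNIV \<phi>" using assms(1) by (auto simp: smooth_on_def simp del: Ck_on.simps)
  then have D: "\<phi> differentiable (at s)" for s by auto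
  show d: "(\<phi> has_real_derivative deriv \<phi> s) (at s)" for s
    using D by (simp add: DERIV_deriv_iff_real_differentiable)
  have "(\<lambda>s. frechet_derivative \<phi> (at s) 1) = deriv \<phi>"
  proof
    fix s
    show "frechet_derivative \<phi> (at s) 1 = deriv \<phi> s"
      using frechet_derivative_at[OF d[of s, unfolded has_field_derivative_def]] by (metis mult.right_neutral)
  qed
  moreover have "continuous_on UNIV (\<lambda>s. frechet_derivative \<phi> (at s) 1)"
    using C1 by simp
  ultimately show c: "continuous_on UNIV (deriv \<phi>)" by (simp only:)
  show z: "deriv \<phi> s = 0" if "\<bar>s\<bar> > R" for s
  proof -
    have "open {s::real. \<bar>s\<bar> > R}" by (intro open_Collect_less continuous_intros)
    from has_field_derivative_transform_within_open[OF DERIV_const this, of s 0 \<phi>]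
    have "(\<phi> has_real_derivative 0) (at s)" using that assms(2) by auto
    then show ?thesis by (simp add: DERIV_imp_deriv)
  qed
  show "deriv \<phi> \<in> L2" using c z by (rule compact_support_L2)
  have "continuous_on UNIV \<phi>" using d DERIV_isCont continuous_at_imp_continuous_on by blast
  then show "\<phi> \<in> L2" using assms(2) by (rule compact_support_L2)
qed

text \<open>Serves to reassemble a solution from the two scalar equations, with \<open>S\<close> and
  \<open>T\<close> the projections onto the eigenspaces.\<close>

lemma weak_derivative_linear_add:
  assumes u: "u \<in> L2" "u' \<in> L2" "weak_derivative u u'" and v: "v \<in> L2" "v' \<in> L2" "weak_derivative v v'"
    and S: "bounded_linear S" and T: "bounded_linear T"
  shows "weak_derivative (\<lambda>s. S (u s) + T (v s)) (\<lambda>s. S (u' s) + T (v' s))"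
  unfolding weak_derivative_def
proof (intro allI impI)
  fix \<phi> :: "real \<Rightarrow> real" assume *: "smooth_on UNIV \<phi> \<and> (\<exists>R. \<forall>s. \<bar>s\<bar> > R \<longrightarrow> \<phi> s = 0)"
  then obtain R where R: "\<And>s. \<bar>s\<bar> > R \<Longrightarrow> \<phi> s = 0" by blast
  note \<phi> = test_functionE[OF conjunct1[OF *] R]
  have lin: "integrable lborel (\<lambda>s. A (k s *\<^sub>R w s))" "(\<integral>s. A (k s *\<^sub>R w s) \<partial>lborel) = A (\<integral>s. k s *\<^sub>R w s \<partial>lborel)"
    if "w \<in> L2" "k \<in> L2" "bounded_linear A" for A w and k :: "real \<Rightarrow> real"
    using integrable_bounded_linear[OF that(3) L2_integrable_scaleR[OF that(2,1)]]
      integral_bounded_linear[OF that(3) L2_integrable_scaleR[OF that(2,1)]] by auto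
  have split: "(\<integral>s. k s *\<^sub>R (S (a s) + T (b s)) \<partial>lborel) = S (\<integral>s. k s *\<^sub>R a s \<partial>lborel) + T (\<integral>s. k s *\<^sub>R b s \<partial>lborel)"
    if "a \<in> L2" "b \<in> L2" "k \<in> L2" for a b and k :: "real \<Rightarrow> real"
    using lin[OF that(1,3) S] lin[OF that(2,3) T]
    by (simp add: scaleR_right_distrib linear_scale[OF bounded_linear.linear[OF S], symmetric]
        linear_scale[OF bounded_linear.linear[OF T], symmetric])
  have "(\<integral>s. deriv \<phi> s *\<^sub>R u s \<partial>lborel) = - (\<integral>s. \<phi> s *\<^sub>R u' s \<partial>lborel)"
    "(\<integral>s. deriv \<phi> s *\<^sub>R v s \<partial>lborel) = - (\<integral>s. \<phi> s *\<^sub>R v' s \<partial>lborel)"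
    using u(3) v(3) * by (auto simp: weak_derivative_def)
  then show "(\<integral>s. deriv \<phi> s *\<^sub>R (S (u s) + T (v s)) \<partial>lborel) = - (\<integral>s. \<phi> s *\<^sub>R (S (u' s) + T (v' s)) \<partial>lborel)"
    using u v \<phi>(4,5) by (simp add: split linear_neg[OF bounded_linear.linear[OF S]] linear_neg[OF bounded_linear.linear[OF T]])
qed

text \<open>The solution is \<open>c\<close> times the convolution of \<open>z\<close>. The equation
  is verified only weakly: after moving the convolution onto the test function, it becomes the
  derivative formula for smooth functions, so \<open>z\<close> need not be differentiated.\<close>

lemma L2_solution_pm_one:
  fixes z :: "real \<Rightarrow> 'a::euclidean_space"
  assumes z: "z \<in> L2" and c: "\<bar>c\<bar> = 1"
  obtains u where "u \<in> L2" "(\<lambda>s. z s - c *\<^sub>R u s) \<in> L2" "weak_derivative u (\<lambda>s. z s - c *\<^sub>R u s)"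
proof
  define \<mu> where "\<mu> = density lborel (exponential_density 1)"
  have \<mu>: "prob_space \<mu>" "sets \<mu> = sets borel"
    unfolding \<mu>_def by (auto intro: prob_space_exponential_density)
  define a where "a = convolve \<mu> c z"
  have a: "a \<in> L2" unfolding a_def by (rule convolve_L2[OF \<mu> z])
  have "c = 1 \<or> c = -1" using c by linarith
  then have c2: "c * c = 1" by auto
  \<comment> \<open>From \<open>c a' + a = z\<close> and \<open>c * c = 1\<close>, the function
    \<open>u = c a\<close> satisfies \<open>u' = z - a = z - c u\<close>.\<close>
  show u: "(\<lambda>s. c *\<^sub>R a s) \<in> L2" by (rule L2_bounded_linear[OF a]) (rule bounded_linear_scaleR_right)
  have "(\<lambda>s. c *\<^sub>R c *\<^sub>R a s) \<in> L2" by (rule L2_bounded_linear[OF u]) (rule bounded_linear_scaleR_right)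
  then show u': "(\<lambda>s. z s - c *\<^sub>R c *\<^sub>R a s) \<in> L2" by (rule L2_diff[OF z])
  show "weak_derivative (\<lambda>s. c *\<^sub>R a s) (\<lambda>s. z s - c *\<^sub>R c *\<^sub>R a s)"
    unfolding weak_derivative_def
  proof (intro allI impI)
    fix \<phi> :: "real \<Rightarrow> real" assume *: "smooth_on UNIV \<phi> \<and> (\<exists>R. \<forall>s. \<bar>s\<bar> > R \<longrightarrow> \<phi> s = 0)"
    then obtain R where R: "\<And>s. \<bar>s\<bar> > R \<Longrightarrow> \<phi> s = 0" by blast
    note \<phi> = test_functionE[OF conjunct1[OF *] R]
    have cm: "\<bar>-c\<bar> = 1" using c by simp
    have conv: "convolve \<mu> (-c) (deriv \<phi>) s = - c * (\<phi> s - convolve \<mu> (-c) \<phi> s)" for s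
      unfolding \<mu>_def by (rule convolve_exponential_deriv[OF cm \<phi>(1,2) R \<phi>(3)])
    have "(\<integral>s. deriv \<phi> s *\<^sub>R a s \<partial>lborel) = (\<integral>s. convolve \<mu> (-c) (deriv \<phi>) s *\<^sub>R z s \<partial>lborel)"
      unfolding a_def by (rule integral_scaleR_convolve[OF \<mu> z \<phi>(5)])
    also have "\<dots> = (\<integral>s. (- c * (\<phi> s - convolve \<mu> (-c) \<phi> s)) *\<^sub>R z s \<partial>lborel)"
      by (simp only: conv)
    also have "\<dots> = (\<integral>s. - c *\<^sub>R (\<phi> s *\<^sub>R z s - convolve \<mu> (-c) \<phi> s *\<^sub>R z s) \<partial>lborel)"
      by (simp add: algebra_simps)
    also have "\<dots> = - c *\<^sub>R ((\<integral>s. \<phi> s *\<^sub>R z s \<partial>lborel) - (\<integral>s. convolve \<mu> (-c) \<phi> s *\<^sub>R z s \<partial>lborel))"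
      using L2_integrable_scaleR[OF \<phi>(4) z] L2_integrable_scaleR[OF convolve_L2[OF \<mu> \<phi>(4)] z]
      by (subst integral_scaleR_right, subst Bochner_Integration.integral_diff) auto
    also have "\<dots> = - c *\<^sub>R ((\<integral>s. \<phi> s *\<^sub>R z s \<partial>lborel) - (\<integral>s. \<phi> s *\<^sub>R a s \<partial>lborel))"
      unfolding a_def by (simp only: integral_scaleR_convolve[OF \<mu> z \<phi>(4)])
    also have "\<dots> = - c *\<^sub>R (\<integral>s. \<phi> s *\<^sub>R (z s - a s) \<partial>lborel)"
      using L2_integrable_scaleR[OF \<phi>(4) z] L2_integrable_scaleR[OF \<phi>(4) a]
      by (subst Bochner_Integration.integral_diff[symmetric]) (auto simp: scaleR_right_diff_distrib)
    finally have E: "(\<integral>s. deriv \<phi> s *\<^sub>R a s \<partial>lborel) = - c *\<^sub>R (\<integral>s. \<phi> s *\<^sub>R (z s - a s) \<partial>lborel)" .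
    have "c *\<^sub>R (\<integral>s. deriv \<phi> s *\<^sub>R a s \<partial>lborel) = - (\<integral>s. \<phi> s *\<^sub>R (z s - a s) \<partial>lborel)"
      unfolding E by (simp only: scaleR_scaleR mult_minus_right c2 scaleR_minus1_left)
    moreover have "(\<integral>s. deriv \<phi> s *\<^sub>R c *\<^sub>R a s \<partial>lborel) = c *\<^sub>R (\<integral>s. deriv \<phi> s *\<^sub>R a s \<partial>lborel)"
      by (simp only: integral_scaleR_right[symmetric] scaleR_left_commute[of c])
    ultimately show "(\<integral>s. deriv \<phi> s *\<^sub>R c *\<^sub>R a s \<partial>lborel) = - (\<integral>s. \<phi> s *\<^sub>R (z s - c *\<^sub>R c *\<^sub>R a s) \<partial>lborel)"
      by (simp only: scaleR_scaleR[of c c] c2 scaleR_one)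
  qed
qed

text \<open>The eigenspaces of the involution decouple \<open>u' + L u = z\<close> into \<open>u' + u = z\<close> and \<open>u' - u = z\<close>.\<close>

lemma L2_solution_involution:
  fixes z :: "real \<Rightarrow> 'a::euclidean_space"
  assumes z: "z \<in> L2" and L: "linear L" "\<And>v. L (L v) = v"
  shows "\<exists>u\<in>L2. \<exists>u'\<in>L2. weak_derivative u u' \<and> (\<forall>s. u' s + L (u s) = z s)"
proof -
  obtain a where a: "a \<in> L2" "(\<lambda>s. z s - 1 *\<^sub>R a s) \<in> L2" "weak_derivative a (\<lambda>s. z s - 1 *\<^sub>R a s)"
    using L2_solution_pm_one[OF z, of 1] by auto
  obtain b where b: "b \<in> L2" "(\<lambda>s. z s - (-1) *\<^sub>R b s) \<in> L2" "weak_derivative b (\<lambda>s. z s - (-1) *\<^sub>R b s)"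
    using L2_solution_pm_one[OF z, of "-1"] by auto
  define P Q where "P v = (1/2) *\<^sub>R (v + L v)" and "Q v = (1/2) *\<^sub>R (v - L v)" for v
  have PQ: "linear P" "linear Q"
    unfolding P_def Q_def
    by (intro linear_compose_scale_right linear_compose_add linear_compose_sub linear_ident L(1))+
  have bPQ: "bounded_linear P" "bounded_linear Q" using PQ by (auto simp: linear_linear)
  show ?thesis
  proof (intro bexI conjI allI)
    show "weak_derivative (\<lambda>s. P (a s) + Q (b s)) (\<lambda>s. P (z s - 1 *\<^sub>R a s) + Q (z s - (-1) *\<^sub>R b s))"
      by (rule weak_derivative_linear_add[OF a b bPQ])
    show "(\<lambda>s. P (a s) + Q (b s)) \<in> L2" "(\<lambda>s. P (z s - 1 *\<^sub>R a s) + Q (z s - (-1) *\<^sub>R b s)) \<in> L2"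
      by (rule L2_add[OF L2_bounded_linear[OF a(1) bPQ(1)] L2_bounded_linear[OF b(1) bPQ(2)]],
          rule L2_add[OF L2_bounded_linear[OF a(2) bPQ(1)] L2_bounded_linear[OF b(2) bPQ(2)]])
    fix s
    have "L (P v) = P v" "L (Q v) = - Q v" "P v + Q v = v" for v
      by (simp_all add: P_def Q_def L(2) linear_cmul[OF L(1)] linear_add[OF L(1)] linear_diff[OF L(1)]
          algebra_simps flip: scaleR_add_left)
    then show "P (z s - 1 *\<^sub>R a s) + Q (z s - (-1) *\<^sub>R b s) + L (P (a s) + Q (b s)) = z s"
      by (simp add: linear_add[OF L(1)] linear_diff[OF L(1)] linear_diff[OF PQ(1)] linear_add[OF PQ(2)] algebra_simps)
  qed
qed

section \<open>Gradient flow for constant metrics\<close>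

lemma smooth_on_Ck: "smooth_on S f \<Longrightarrow> Ck_on k S f"
  by (simp add: smooth_on_def)

lemma smooth_on_has_derivative:
  assumes "smooth_on S f" "x \<in> S"
  shows "(f has_derivative frechet_derivative f (at x)) (at x)"
  using smooth_on_Ck[OF assms(1), of "Suc 0"] assms(2) by (auto simp: frechet_derivative_works)

lemma smooth_on_directional:
  assumes "smooth_on S f"
  shows "smooth_on S (\<lambda>x. frechet_derivative f (at x) v)"
  unfolding smooth_on_def using smooth_on_Ck[OF assms] Ck_on.simps(2) by blast

lemma smooth_on_imp_continuous_on: "smooth_on S f \<Longrightarrow> continuous_on S f"
  using smooth_on_Ck[of S f 0] by simp

lemma smooth_on_linear_derivative:
  assumes "smooth_on S f" "x \<in> S"
  shows "linear (frechet_derivative f (at x))"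
  using smooth_on_has_derivative[OF assms] by (rule has_derivative_linear)

lemma smooth_on_has_derivative_hessian:
  assumes "smooth_on S f" "x \<in> S"
  shows "((\<lambda>y. frechet_derivative f (at y) v) has_derivative hessian f x v) (at x)"
proof -
  have "hessian f x v = frechet_derivative (\<lambda>y. frechet_derivative f (at y) v) (at x)"
    by (simp add: hessian_def fun_eq_iff)
  then show ?thesis using smooth_on_has_derivative[OF smooth_on_directional[OF assms(1)] assms(2)] by simp
qed

lemma hessian_eqI:
  assumes "open S" "x \<in> S" "\<And>y. y \<in> S \<Longrightarrow> frechet_derivative f (at y) v = h y"
    and "(h has_derivative h') (at x)"
  shows "hessian f x v w = h' w"
proof -
  have "((\<lambda>y. frechet_derivative f (at y) v) has_derivative h') (at x)"
    using has_derivative_transform_within_open[OF assms(4,1,2)] assms(3) by simp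
  then show ?thesis unfolding hessian_def by (simp add: frechet_derivative_at[symmetric])
qed

lemma bilinear_hessian:
  assumes "open S" "smooth_on S f" "x \<in> S"
  shows "bilinear (hessian f x)"
  unfolding bilinear_def
proof (intro conjI allI)
  note D = smooth_on_has_derivative_hessian[OF assms(2,3)]
  show "linear (hessian f x v)" for v using D by (rule has_derivative_linear)
  fix w
  show "linear (\<lambda>v. hessian f x v w)"
  proof (rule linearI)
    fix v v' and r :: real
    show "hessian f x (v + v') w = hessian f x v w + hessian f x v' w"
      by (rule hessian_eqI[OF assms(1,3) _ has_derivative_add[OF D D]])
        (simp add: linear_add[OF smooth_on_linear_derivative[OF assms(2)]])
    show "hessian f x (r *\<^sub>R v) w = r *\<^sub>R hessian f x v w"
      by (rule hessian_eqI[OF assms(1,3) _ has_derivative_scaleR_right[OF D]])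
        (simp add: linear_scale[OF smooth_on_linear_derivative[OF assms(2)]])
  qed
qed

lemma crit_points_iff:
  assumes "smooth_on S f" "x \<in> S"
  shows "x \<in> crit_points T f \<longleftrightarrow> x \<in> T \<and> (\<forall>v. frechet_derivative f (at x) v = 0)"
proof -
  have "(f has_derivative (\<lambda>v. 0)) (at x) \<longleftrightarrow> frechet_derivative f (at x) = (\<lambda>v. 0)"
    using smooth_on_has_derivative[OF assms] frechet_derivative_at by metis
  then show ?thesis by (auto simp: crit_points_def fun_eq_iff)
qed

lemma smooth_on_const: "smooth_on S (\<lambda>x. c)"
proof -
  have "Ck_on k S (\<lambda>x. c)" for k and c :: 'b
    by (induction k arbitrary: c) (auto simp: frechet_derivative_const)
  then show ?thesis by (simp add: smooth_on_def)
qed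

text \<open>A constant Riemannian metric: gradients below are taken with respect to the same inner
  product \<open>G\<close> at every point.\<close>

locale inner_form =
  fixes G :: "'a::euclidean_space \<Rightarrow> 'a \<Rightarrow> real"
  assumes bilinear: "bilinear G"
    and sym: "G v w = G w v"
    and pos: "v \<noteq> 0 \<Longrightarrow> G v v > 0"
begin

lemma nondegenerate: "(\<And>v. G u v = 0) \<Longrightarrow> u = 0"
  using pos[of u] by force

text \<open>The minimum over the compact unit sphere is positive; homogeneity of degree 2 does the
  rest.\<close>

lemma coercive: obtains c where "c > 0" "\<And>v. c * (norm v)\<^sup>2 \<le> G v v"
proof -
  have bl: "bounded_bilinear G" using bilinear by (simp add: bilinear_conv_bounded_bilinear)
  have "continuous_on (sphere 0 1) (\<lambda>v. G v v)"
    by (rule bounded_bilinear.continuous_on[OF bl continuous_on_id continuous_on_id])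
  moreover have "compact (sphere (0::'a) 1)" "sphere (0::'a) 1 \<noteq> {}" by auto
  ultimately obtain e where e: "norm e = 1" "\<And>v. norm v = 1 \<Longrightarrow> G e e \<le> G v v"
    using continuous_attains_inf[of "sphere 0 1" "\<lambda>v. G v v"] by (auto simp: dist_norm)
  show thesis
  proof
    show "G e e > 0" using pos[of e] e(1) by force
    fix v
    show "G e e * (norm v)\<^sup>2 \<le> G v v"
    proof (cases "v = 0")
      case True then show ?thesis using bilinear_lzero[OF bilinear] by simp
    next
      case False
      define u where "u = v /\<^sub>R norm v"
      have v: "v = norm v *\<^sub>R u" using False by (simp add: u_def)
      have "G v v = (norm v)\<^sup>2 * G u u"
        by (subst (1 2) v) (simp add: bilinear_lmul[OF bilinear] bilinear_rmul[OF bilinear] power2_eq_square)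
      moreover have "G e e \<le> G u u" using False by (intro e(2)) (simp add: u_def)
      ultimately show ?thesis by (simp add: mult.commute[of _ "G _ _"] mult_right_mono)
    qed
  qed
qed

text \<open>\<open>R\<close> is the inverse of the Gram operator \<open>J\<close>, which is
  injective because \<open>G\<close> is definite. It writes the \<open>G\<close>-gradient as a fixed
  linear map applied to the Euclidean one, so that the gradient can be differentiated.\<close>

lemma riesz: obtains R where "linear R" "\<And>u v. G (R u) v = u \<bullet> v"
proof -
  define J where "J u = (\<Sum>b\<in>Basis. G u b *\<^sub>R b)" for u
  have lin1: "linear (G u)" "linear (\<lambda>u. G u v)" for u v using bilinear by (auto simp: bilinear_def)
  have J: "J u \<bullet> v = G u v" for u v
  proof -
    have "G u v = G u (\<Sum>b\<in>Basis. (v \<bullet> b) *\<^sub>R b)" by (simp add: euclidean_representation)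
    also have "\<dots> = (\<Sum>b\<in>Basis. (v \<bullet> b) * G u b)"
      by (simp add: linear_sum[OF lin1(1)] linear_scale[OF lin1(1)])
    also have "\<dots> = J u \<bullet> v" by (simp add: J_def inner_sum_left inner_commute[of v] mult.commute)
    finally show ?thesis by simp
  qed
  have "linear J"
    by (rule linearI; rule vector_eq_rdot[THEN iffD1])
      (simp_all add: J inner_add_left bilinear_ladd[OF bilinear] bilinear_lmul[OF bilinear])
  moreover have "inj J"
    unfolding linear_injective_0[OF \<open>linear J\<close>] using J nondegenerate by (metis inner_zero_left)
  ultimately obtain R where "linear R" "\<And>u. J (R u) = u"
    using linear_injective_isomorphism by metis
  then show thesis using J that by metis
qed

lemma gradient_unique:
  assumes "\<And>v. G u v = frechet_derivative f (at x) v"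
  shows "gradient (\<lambda>x. G) f x = u"
  unfolding gradient_def
proof (rule the_equality)
  fix u' assume u': "\<forall>v. G u' v = frechet_derivative f (at x) v"
  have "u' - u = 0" by (rule nondegenerate) (simp add: bilinear_lsub[OF bilinear] u' assms)
  then show "u' = u" by simp
qed (use assms in simp)

lemma gradient_eq:
  assumes R: "\<And>u v. G (R u) v = u \<bullet> v" and f: "smooth_on S f" "x \<in> S"
  shows "gradient (\<lambda>x. G) f x = R (\<Sum>b\<in>Basis. frechet_derivative f (at x) b *\<^sub>R b)"
proof (rule gradient_unique)
  fix v
  note lin = smooth_on_linear_derivative[OF f]
  have "frechet_derivative f (at x) v = frechet_derivative f (at x) (\<Sum>b\<in>Basis. (v \<bullet> b) *\<^sub>R b)"
    by (simp add: euclidean_representation)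
  also have "\<dots> = (\<Sum>b\<in>Basis. frechet_derivative f (at x) b *\<^sub>R b) \<bullet> v"
    by (simp add: linear_sum[OF lin] linear_scale[OF lin] inner_sum_left inner_commute[of v] mult.commute)
  finally show "G (R (\<Sum>b\<in>Basis. frechet_derivative f (at x) b *\<^sub>R b)) v = frechet_derivative f (at x) v"
    by (simp add: R)
qed

lemma gradient_inner:
  assumes "smooth_on S f" "x \<in> S"
  shows "G (gradient (\<lambda>x. G) f x) v = frechet_derivative f (at x) v"
proof -
  obtain R where R: "\<And>u v. G (R u) v = u \<bullet> v" using riesz by metis
  note lin = smooth_on_linear_derivative[OF assms]
  have "G (gradient (\<lambda>x. G) f x) v = (\<Sum>b\<in>Basis. (v \<bullet> b) * frechet_derivative f (at x) b)"
    by (simp add: gradient_eq[OF R assms] R inner_sum_left inner_commute[of v] mult.commute)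
  also have "\<dots> = frechet_derivative f (at x) (\<Sum>b\<in>Basis. (v \<bullet> b) *\<^sub>R b)"
    by (simp add: linear_sum[OF lin] linear_scale[OF lin])
  finally show ?thesis by (simp add: euclidean_representation)
qed

text \<open>The function decreases strictly along nonconstant flow lines.\<close>

lemma closed_flow_line_const:
  assumes M: "smooth_on M f" "S \<subseteq> M" "open M" "x0 \<in> M"
    and x: "x \<in> flow_lines S f (\<lambda>x. G) x0 x0"
  shows "x s = x0"
proof -
  define D where "D s = gradient (\<lambda>x. G) f (x s)" for s
  have dx: "(x has_vector_derivative - D s) (at s)" and xM: "x s \<in> M" for s
    using x M by (auto simp: flow_lines_def D_def)
  have lim: "filterlim x (nhds x0) at_bot" "filterlim x (nhds x0) at_top"
    using x by (auto simp: flow_lines_def)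
  have cont: "isCont f x0"
    using smooth_on_imp_continuous_on[OF M(1)] M(3,4) continuous_on_eq_continuous_at by blast
  have df: "((\<lambda>s. f (x s)) has_real_derivative - G (D s) (D s)) (at s)" for s
  proof -
    have "((f \<circ> x) has_vector_derivative frechet_derivative f (at (x s)) (- D s)) (at s)"
      by (rule vector_derivative_diff_chain_within[OF dx])
        (rule has_derivative_at_withinI[OF smooth_on_has_derivative[OF M(1) xM]])
    moreover have "frechet_derivative f (at (x s)) (- D s) = - G (D s) (D s)"
      using gradient_inner[OF M(1) xM, of s "- D s"] by (simp add: D_def bilinear_rneg[OF bilinear])
    ultimately show ?thesis by (simp add: has_real_derivative_iff_has_vector_derivative o_def)
  qed
  have nonneg: "G v v \<ge> 0" for v using pos[of v] bilinear_lzero[OF bilinear, of v] by (cases "v = 0") auto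
  have anti: "f (x t) \<le> f (x s)" if "s \<le> t" for s t
    by (rule DERIV_nonpos_imp_nonincreasing[OF that]) (use df nonneg in \<open>force\<close>)
  have flim: "((\<lambda>s. f (x s)) \<longlongrightarrow> f x0) at_bot" "((\<lambda>s. f (x s)) \<longlongrightarrow> f x0) at_top"
    using isCont_tendsto_compose[OF cont lim(1)] isCont_tendsto_compose[OF cont lim(2)] by auto
  have "f (x s) \<le> f x0" for s
    by (rule tendsto_lowerbound[OF flim(1)]) (auto simp: eventually_at_bot_linorder intro!: exI[of _ s] anti)
  moreover have "f (x s) \<ge> f x0" for s
    by (rule tendsto_upperbound[OF flim(2)]) (auto simp: eventually_at_top_linorder intro!: exI[of _ s] anti)
  ultimately have "(\<lambda>s. f (x s)) = (\<lambda>s. f x0)" by (simp add: antisym fun_eq_iff)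
  then have "G (D s) (D s) = 0" for s using DERIV_unique[OF df[of s], of 0] by simp
  then have D0: "D s = 0" for s using pos[of "D s"] by force
  have "\<exists>c. \<forall>s\<in>UNIV. x s = c"
    by (rule has_vector_derivative_zero_constant[OF convex_UNIV]) (use dx D0 in auto)
  then obtain c where "x = (\<lambda>s. c)" by auto
  moreover have "c = x0"
    by (rule tendsto_unique[OF _ _ lim(2)]) (auto simp: \<open>x = (\<lambda>s. c)\<close>)
  ultimately show ?thesis by simp
qed

end

text \<open>The condition in \<open>F_Morse_local\<close> concerns flow lines of the flat metric,
  whatever metric is chosen afterwards.\<close>

interpretation flat: inner_form "(\<bullet>) :: 'a::euclidean_space \<Rightarrow> 'a \<Rightarrow> real"
  by unfold_locales (auto simp: bilinear_conv_bounded_bilinear bounded_bilinear_inner inner_commute)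

section \<open>Nondegenerate critical points\<close>

text \<open>Every nondegenerate symmetric form \<open>H\<close> is \<open>G (L v) w\<close> for an inner product \<open>G\<close> and a
  \<open>G\<close>-orthogonal involution \<open>L\<close>; \<open>L\<close> is then the derivative of the \<open>G\<close>-gradient, and its
  \<open>-1\<close>-eigenspace is a maximal negative subspace of \<open>H\<close>.\<close>

locale nondegenerate_critical_point = inner_form G
  for G :: "'a::euclidean_space \<Rightarrow> 'a \<Rightarrow> real" +
  fixes M :: "'a set" and ft :: "'a \<Rightarrow> real" and x0 :: 'a and L :: "'a \<Rightarrow> 'a"
  assumes M: "open M" "smooth_on M ft" "x0 \<in> M"
    and crit: "frechet_derivative ft (at x0) v = 0"
    and L: "linear L" "L (L v) = v" "G (L v) (L w) = G v w"
    and hess: "hessian ft x0 v w = G (L v) w"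
begin

lemma self_adjoint: "G (L v) w = G v (L w)"
  using L(3)[of "L v" w] L(2) by simp

lemma bounds: obtains c K where "c > 0" "K \<ge> 1" "\<And>v. c * (norm v)\<^sup>2 \<le> G v v" "\<And>v. norm (L v) \<le> K * norm v"
proof -
  obtain c where c: "c > 0" "\<And>v. c * (norm v)\<^sup>2 \<le> G v v" using coercive by metis
  have "bounded_linear L" using L(1) by (simp add: linear_linear)
  then obtain K where K: "\<And>v. norm (L v) \<le> norm v * K" using bounded_linear.bounded by metis
  show thesis
  proof (rule that[of c "max K 1"])
    fix v show "norm (L v) \<le> max K 1 * norm v"
      by (rule order_trans[OF K]) (simp add: mult.commute[of "norm v"] mult_right_mono)
  qed (use c in auto)
qed

lemma hessian_near:
  assumes "\<mu> > 0"
  obtains r where "r > 0" "cball x0 r \<subseteq> M"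
    "\<And>x v w. dist x0 x \<le> r \<Longrightarrow> \<bar>hessian ft x v w - G (L v) w\<bar> \<le> \<mu> * norm v * norm w"
proof -
  let ?N = "real DIM('a)"
  \<comment> \<open>The bilinear form is expanded in the basis into DIM squared entries, among which
    the error \<mu> is divided.\<close>
  define \<nu> where "\<nu> = \<mu> / (?N * ?N)"
  have N: "?N > 0" and \<nu>: "\<nu> > 0" using assms by (auto simp: \<nu>_def)
  have "\<forall>\<^sub>F x in nhds x0. x \<in> M \<and> (\<forall>a\<in>Basis. \<forall>b\<in>Basis. \<bar>hessian ft x a b - hessian ft x0 a b\<bar> < \<nu>)"
  proof (intro eventually_conj eventually_ball_finite finite_Basis ballI)
    show "\<forall>\<^sub>F x in nhds x0. x \<in> M" using M eventually_nhds by blast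
    fix a b :: 'a
    have "continuous_on M (\<lambda>x. hessian ft x a b)"
      unfolding hessian_def by (intro smooth_on_imp_continuous_on smooth_on_directional M)
    then have "isCont (\<lambda>x. hessian ft x a b) x0" using M continuous_on_eq_continuous_at by blast
    then have "filterlim (\<lambda>x. hessian ft x a b) (nhds (hessian ft x0 a b)) (nhds x0)"
      using tendsto_at_iff_tendsto_nhds[of "\<lambda>x. hessian ft x a b" x0] by (simp add: isCont_def)
    then show "\<forall>\<^sub>F x in nhds x0. \<bar>hessian ft x a b - hessian ft x0 a b\<bar> < \<nu>"
      using \<nu> unfolding tendsto_iff dist_real_def by blast
  qed
  then obtain d where d: "d > 0" "\<And>x. dist x x0 < d \<Longrightarrow>
      x \<in> M \<and> (\<forall>a\<in>Basis. \<forall>b\<in>Basis. \<bar>hessian ft x a b - hessian ft x0 a b\<bar> < \<nu>)"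
    unfolding eventually_nhds_metric by blast
  show thesis
  proof (rule that[of "d/2"])
    show "cball x0 (d/2) \<subseteq> M" using d by (auto simp: dist_commute)
    fix x v w assume "dist x0 x \<le> d/2"
    then have x: "x \<in> M" "\<And>a b. a \<in> Basis \<Longrightarrow> b \<in> Basis \<Longrightarrow> \<bar>hessian ft x a b - hessian ft x0 a b\<bar> \<le> \<nu>"
      using d(1) d(2)[of x] by (auto simp: dist_commute less_imp_le)
    have expand: "hessian ft y v w = (\<Sum>a\<in>Basis. \<Sum>b\<in>Basis. (v \<bullet> a) * (w \<bullet> b) * hessian ft y a b)" if "y \<in> M" for y
    proof -
      note bl = bilinear_hessian[OF M(1,2) that]
      have "hessian ft y v w = hessian ft y (\<Sum>a\<in>Basis. (v \<bullet> a) *\<^sub>R a) (\<Sum>b\<in>Basis. (w \<bullet> b) *\<^sub>R b)"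
        by (simp add: euclidean_representation)
      also have "\<dots> = (\<Sum>(a, b)\<in>Basis \<times> Basis. hessian ft y ((v \<bullet> a) *\<^sub>R a) ((w \<bullet> b) *\<^sub>R b))"
        by (rule bilinear_sum[OF bl])
      finally show ?thesis
        by (simp add: bilinear_lmul[OF bl] bilinear_rmul[OF bl] sum.cartesian_product mult_ac)
    qed
    have "\<bar>hessian ft x v w - hessian ft x0 v w\<bar>
       = \<bar>\<Sum>a\<in>Basis. \<Sum>b\<in>Basis. (v \<bullet> a) * (w \<bullet> b) * (hessian ft x a b - hessian ft x0 a b)\<bar>"
      by (simp add: expand x M(3) sum_subtractf right_diff_distrib)
    also have "\<dots> \<le> (\<Sum>a\<in>Basis. \<Sum>b\<in>Basis. \<bar>(v \<bullet> a) * (w \<bullet> b) * (hessian ft x a b - hessian ft x0 a b)\<bar>)"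
      by (intro order_trans[OF sum_abs] sum_mono sum_abs)
    also have "\<dots> \<le> (\<Sum>a\<in>(Basis::'a set). \<Sum>b\<in>(Basis::'a set). norm v * norm w * \<nu>)"
      using \<nu> by (intro sum_mono) (auto simp: abs_mult Basis_le_norm x intro!: mult_mono)
    also have "\<dots> = \<mu> * norm v * norm w" using N by (simp add: \<nu>_def)
    finally show "\<bar>hessian ft x v w - G (L v) w\<bar> \<le> \<mu> * norm v * norm w" by (simp add: hess)
  qed (use d in auto)
qed

text \<open>Since \<open>L\<close> is the derivative of the gradient at \<open>x0\<close> and is its own inverse,
  \<open>x \<mapsto> x - L (\<nabla>f x)\<close> is a simplified Newton iteration.\<close>

lemma unique_crit_point_near:
  assumes c: "c > 0" "\<And>v. c * (norm v)\<^sup>2 \<le> G v v" and K: "K > 0" "\<And>v. norm (L v) \<le> K * norm v"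
    and r: "r > 0" "cball x0 r \<subseteq> M" and f: "smooth_on M f"
    and hf: "\<And>x v w. dist x0 x \<le> r \<Longrightarrow> \<bar>hessian f x v w - G (L v) w\<bar> \<le> c / (2 * K) * norm v * norm w"
    and df: "\<And>v. \<bar>frechet_derivative f (at x0) v\<bar> \<le> c * r / (2 * K) * norm v"
  shows "\<exists>y. crit_points (cball x0 r) f = {y}"
proof -
  define D where "D = gradient (\<lambda>x. G) f"
  have D: "G (D x) v = frechet_derivative f (at x) v" if "x \<in> M" for x v
    unfolding D_def by (rule gradient_inner[OF f that])
  define T where "T x = x - L (D x)" for x
  \<comment> \<open>By coercivity \<open>G e e\<close> is at least \<open>c\<close> times the square
    of \<open>norm e\<close>; one factor \<open>norm e\<close> cancels.\<close>
  have le: "norm e \<le> a" if "G e e \<le> c * a * norm e" "a \<ge> 0" for e a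
  proof (cases "e = 0")
    case False
    then have "c * norm e * norm e \<le> c * a * norm e" using c(2)[of e] that(1) by (simp add: power2_eq_square mult.assoc)
    then show ?thesis using False c(1) by simp
  qed (use that in simp)
  have contr: "dist (T x) (T y) \<le> 1/2 * dist x y" if "x \<in> cball x0 r" "y \<in> cball x0 r" for x y
  proof -
    define e where "e = T x - T y"
    define p where "p t = y + t *\<^sub>R (x - y)" for t :: real
    have xy: "x \<in> M" "y \<in> M" using that r by auto
    have p: "dist x0 (p t) \<le> r" if "0 \<le> t" "t \<le> 1" for t
    proof -
      have "p t = (1 - t) *\<^sub>R y + t *\<^sub>R x" by (simp add: p_def algebra_simps)
      then show ?thesis
        using convexD[OF convex_cball \<open>y \<in> cball x0 r\<close> \<open>x \<in> cball x0 r\<close>, of "1 - t" t] that by simp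
    qed
    have "((\<lambda>t. frechet_derivative f (at (p t)) (L e)) has_real_derivative hessian f (p t) (L e) (x - y)) (at t)"
      if t: "0 \<le> t" "t \<le> 1" for t
    proof -
      have pM: "p t \<in> M" using p[OF t] r by auto
      note h = smooth_on_has_derivative_hessian[OF f pM, of "L e"]
      have "(p has_vector_derivative (x - y)) (at t)"
        unfolding p_def by (auto intro!: derivative_eq_intros)
      from vector_derivative_diff_chain_within[OF this has_derivative_at_withinI[OF h]]
      show ?thesis by (simp add: has_real_derivative_iff_has_vector_derivative o_def)
    qed
    \<comment> \<open>With \<open>e\<close> fixed beforehand as the difference of the images, only a
      scalar function on the segment from \<open>y\<close> to \<open>x\<close> is involved, and the
      ordinary mean value theorem gives an exact equality.\<close>
    then obtain t where t: "0 < t" "t < 1"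
      "frechet_derivative f (at (p 1)) (L e) - frechet_derivative f (at (p 0)) (L e) = hessian f (p t) (L e) (x - y)"
      using MVT2[of 0 1 "\<lambda>t. frechet_derivative f (at (p t)) (L e)" "\<lambda>t. hessian f (p t) (L e) (x - y)"] by auto
    have "G e e = G (x - y) e - G (L (D x)) e + G (L (D y)) e"
    proof -
      have "e = (x - y) - L (D x) + L (D y)" by (simp add: e_def T_def)
      then have "G e v = G ((x - y) - L (D x) + L (D y)) v" for v by simp
      then show ?thesis by (simp only: bilinear_lsub[OF bilinear] bilinear_ladd[OF bilinear])
    qed
    \<comment> \<open>Rewriting \<open>e\<close> as \<open>L (L e)\<close> makes the first term the
      model Hessian at the arguments \<open>L e\<close> and \<open>x - y\<close>, so only the
      deviation of the true Hessian from the model remains.\<close>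
    also have "\<dots> = G e (x - y) - (G (D x) (L e) - G (D y) (L e))"
      by (simp add: self_adjoint sym[of "x - y"])
    also have "\<dots> = G (L (L e)) (x - y) - hessian f (p t) (L e) (x - y)"
      using t(3) by (simp add: D xy L(2) p_def)
    also have "\<dots> \<le> c / (2 * K) * norm (L e) * norm (x - y)"
      using hf[OF p, of t "L e" "x - y"] t by simp
    also have "\<dots> \<le> c / (2 * K) * (K * norm e) * norm (x - y)"
      using c K by (intro mult_mono) auto
    also have "\<dots> = c * (norm (x - y) / 2) * norm e" using K by simp
    finally show ?thesis using le[of e "norm (x - y) / 2"] by (simp add: e_def dist_norm)
  qed
  \<comment> \<open>The first iterate uses up half the radius and the contraction factor 1/2 the
    other half, so the ball is mapped into itself.\<close>
  have T0: "norm (T x0 - x0) \<le> r / 2"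
  proof -
    define e where "e = L (D x0)"
    have "G e e = frechet_derivative f (at x0) (L e)" using D M(3) by (simp add: e_def self_adjoint)
    also have "\<dots> \<le> c * r / (2 * K) * norm (L e)" using df[of "L e"] by simp
    also have "\<dots> \<le> c * r / (2 * K) * (K * norm e)" using c K r by (intro mult_left_mono) auto
    also have "\<dots> = c * (r / 2) * norm e" using K by simp
    finally have "norm e \<le> r / 2" using r by (intro le) auto
    then show ?thesis by (simp add: T_def e_def)
  qed
  have maps: "T ` cball x0 r \<subseteq> cball x0 r"
  proof safe
    fix x assume x: "x \<in> cball x0 r"
    have "dist x0 (T x) \<le> dist x0 (T x0) + dist (T x0) (T x)" by (rule dist_triangle)
    moreover have "dist (T x0) (T x) \<le> 1/2 * dist x0 x" using x r by (intro contr) auto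
    moreover have "dist x0 (T x0) \<le> r / 2" using T0 by (simp add: dist_norm norm_minus_commute)
    ultimately show "T x \<in> cball x0 r" using x by auto
  qed
  have "\<exists>!y. y \<in> cball x0 r \<and> T y = y"
    by (rule Banach_fix[of _ "1/2"]) (use r maps contr in \<open>auto simp: complete_eq_closed\<close>)
  moreover have "y \<in> crit_points (cball x0 r) f \<longleftrightarrow> y \<in> cball x0 r \<and> T y = y" for y
  proof (cases "y \<in> cball x0 r")
    case True
    then have y: "y \<in> M" using r by auto
    have "T y = y \<longleftrightarrow> L (D y) = 0" by (simp add: T_def)
    also have "\<dots> \<longleftrightarrow> D y = 0" using L(1,2) linear_0 by metis
    also have "\<dots> \<longleftrightarrow> (\<forall>v. frechet_derivative f (at y) v = 0)"
      using D[OF y] nondegenerate[of "D y"] bilinear_lzero[OF bilinear] by metis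
    finally show ?thesis using crit_points_iff[OF f y] True by auto
  qed (simp add: crit_points_def)
  ultimately show ?thesis by blast
qed

definition index :: nat where "index = dim {v. L v = - v}"

text \<open>An error of half the coercivity constant leaves the Hessian negative on the
  -1-eigenspace of \<open>L\<close> and positive on the complementary 1-eigenspace. A negative
  subspace meets the latter only in 0, so its dimension cannot exceed that of the former.\<close>

lemma morse_index_near:
  assumes c: "c > 0" "\<And>v. c * (norm v)\<^sup>2 \<le> G v v"
    and h: "\<And>v. \<bar>hessian f y v v - G (L v) v\<bar> \<le> c / 2 * norm v * norm v"
  shows "morse_index f y = index"
proof -
  define P N where "P = {v. L v = v}" and "N = {v. L v = - v}"
  have sub: "subspace P" "subspace N"
    unfolding P_def N_def subspace_def
    by (auto simp: linear_0[OF L(1)] linear_add[OF L(1)] linear_scale[OF L(1)])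
  have half: "c / 2 * norm v * norm v < G v v" if "v \<noteq> 0" for v
  proof -
    have "c / 2 * norm v * norm v < c * (norm v)\<^sup>2" using that c(1) by (simp add: power2_eq_square)
    with c(2)[of v] show ?thesis by simp
  qed
  have neg: "hessian f y v v < 0" if "v \<in> N" "v \<noteq> 0" for v
  proof -
    have "G (L v) v = - G v v" using that(1) by (simp add: N_def bilinear_lneg[OF bilinear])
    then show ?thesis using h[of v] half[OF that(2)] by linarith
  qed
  have pos: "hessian f y v v > 0" if "v \<in> P" "v \<noteq> 0" for v
  proof -
    have "G (L v) v = G v v" using that(1) by (simp add: P_def)
    then show ?thesis using h[of v] half[OF that(2)] by linarith
  qed
  have decomp: "\<exists>p\<in>P. \<exists>n\<in>N. v = p + n" for v
  proof (intro bexI)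
    show "v = (1/2) *\<^sub>R (v + L v) + (1/2) *\<^sub>R (v - L v)" by (simp add: algebra_simps flip: scaleR_add_left)
    show "(1/2) *\<^sub>R (v + L v) \<in> P" "(1/2) *\<^sub>R (v - L v) \<in> N"
      by (simp_all add: P_def N_def linear_scale[OF L(1)] linear_add[OF L(1)] linear_diff[OF L(1)] L(2) algebra_simps)
  qed
  have "{p + n | p n. p \<in> P \<and> n \<in> N} = UNIV" using decomp by blast
  moreover have "P \<inter> N = {0}" using pos neg linear_0[OF L(1)] by (force simp: P_def N_def)
  ultimately have dims: "DIM('a) = dim P + dim N"
    using dim_sums_Int[OF sub] by (simp add: dim_UNIV)
  have upper: "dim W \<le> dim N" if "subspace W" "\<forall>w\<in>W. w \<noteq> 0 \<longrightarrow> hessian f y w w < 0" for W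
  proof -
    have "W \<inter> P = {0}" using that pos subspace_0 sub(1) by force
    then have "dim (W \<inter> P) = 0" by simp
    then have "dim {p + n | p n. p \<in> W \<and> n \<in> P} = dim W + dim P"
      using dim_sums_Int[OF that(1) sub(1)] by (simp only: add_0_right)
    moreover have "dim {p + n | p n. p \<in> W \<and> n \<in> P} \<le> DIM('a)" by (rule dim_subset_UNIV)
    ultimately have "dim W + dim P \<le> DIM('a)" by (simp only:)
    then show ?thesis using dims by simp
  qed
  show ?thesis
    unfolding morse_index_def index_def N_def[symmetric]
  proof (rule Max_eqI)
    show "finite {dim W | W. subspace W \<and> (\<forall>w\<in>W. w \<noteq> 0 \<longrightarrow> hessian f y w w < 0)}"
      by (rule finite_subset[of _ "{..dim N}"]) (use upper in auto)
    show "dim N \<in> {dim W | W. subspace W \<and> (\<forall>w\<in>W. w \<noteq> 0 \<longrightarrow> hessian f y w w < 0)}"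
      using sub neg by blast
  qed (use upper in auto)
qed

end

text \<open>The part of the closed ball inside \<open>M\<close> is closed by compactness, relatively
  open and nonempty, hence everything by connectedness. So an admissible ball contains no point
  outside \<open>M\<close>, in particular no singularity of the potential.\<close>

lemma rball_eq_cball:
  assumes "open M" "x0 \<in> M" "0 \<le> r" "compact (rball M x0 r)"
  shows "rball M x0 r = cball x0 r"
proof -
  have e: "rball M x0 r = cball x0 r \<inter> M" by (auto simp: rball_def)
  have "closedin (top_of_set (cball x0 r)) (cball x0 r \<inter> M)"
    using compact_imp_closed[OF assms(4)] e by (simp add: closed_subset)
  moreover have "openin (top_of_set (cball x0 r)) (cball x0 r \<inter> M)"
    using assms(1) by (rule openin_open_Int)
  moreover have "x0 \<in> cball x0 r \<inter> M" using assms by simp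
  ultimately have "cball x0 r \<inter> M = cball x0 r"
    using connected_clopen[THEN iffD1, OF convex_connected[OF convex_cball]] by blast
  then show ?thesis using e by simp
qed

lemma abs_linear_le_scaled:
  fixes h :: "'a::real_normed_vector \<Rightarrow> real"
  assumes "linear h" "\<And>v. norm v \<le> 1 \<Longrightarrow> \<bar>h v\<bar> \<le> a"
  shows "\<bar>h v\<bar> \<le> a * norm v"
proof (cases "v = 0")
  case False
  define u where "u = v /\<^sub>R norm v"
  have "v = norm v *\<^sub>R u" using False by (simp add: u_def)
  then have "h v = norm v * h u" using linear_scale[OF assms(1), of "norm v" u] by simp
  moreover have "\<bar>h u\<bar> \<le> a" using False by (intro assms(2)) (simp add: u_def)
  ultimately show ?thesis by (simp add: abs_mult mult.commute[of "norm v"] mult_right_mono)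
qed (simp add: linear_0[OF assms(1)])

text \<open>\<open>C2_close\<close> compares values on vectors of norm at most 1; homogeneity
  extends the comparison to all vectors.\<close>

lemma C2_close_scaled:
  assumes "open M" "smooth_on M f" "smooth_on M h" "x \<in> M" "C2_close \<eta> S f h" "x \<in> S"
  shows "\<bar>frechet_derivative f (at x) v - frechet_derivative h (at x) v\<bar> \<le> \<eta> * norm v"
    and "\<bar>hessian f x v w - hessian h x v w\<bar> \<le> \<eta> * norm v * norm w"
proof -
  have C: "\<bar>frechet_derivative f (at x) v - frechet_derivative h (at x) v\<bar> \<le> \<eta>"
    "\<bar>hessian f x v w - hessian h x v w\<bar> \<le> \<eta>" if "norm v \<le> 1" "norm w \<le> 1" for v w
    using assms(5,6) that unfolding C2_close_def by (metis less_imp_le)+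
  note lin = smooth_on_linear_derivative[OF assms(2,4)] smooth_on_linear_derivative[OF assms(3,4)]
  note bl = bilinear_hessian[OF assms(1,2,4)] bilinear_hessian[OF assms(1,3,4)]
  have bl1: "linear (hessian f x v)" "linear (\<lambda>v. hessian f x v w)"
    "linear (hessian h x v)" "linear (\<lambda>v. hessian h x v w)" for v w
    using bl by (auto simp: bilinear_def)
  show "\<bar>frechet_derivative f (at x) v - frechet_derivative h (at x) v\<bar> \<le> \<eta> * norm v"
    by (rule abs_linear_le_scaled[OF linear_compose_sub[OF lin]]) (use C(1)[where w=0] in auto)
  show "\<bar>hessian f x v w - hessian h x v w\<bar> \<le> \<eta> * norm v * norm w"
  proof (rule abs_linear_le_scaled[OF linear_compose_sub[OF bl1(1,3)]])
    fix w :: 'a assume "norm w \<le> 1"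
    then show "\<bar>hessian f x v w - hessian h x v w\<bar> \<le> \<eta> * norm v"
      by (intro abs_linear_le_scaled[OF linear_compose_sub[OF bl1(2,4)]] C(2))
  qed
qed

section \<open>Small perturbations and the existence of regular pairs\<close>

context nondegenerate_critical_point
begin

text \<open>Three regions: in a small ball of radius \<open>r\<close> Newton's method yields exactly
  one critical point, on the shell \<open>A\<close> the derivative of \<open>ft\<close> dominates
  the perturbation, and outside the ball of radius \<delta> the two functions agree.\<close>

lemma perturbed_crit_points:
  assumes \<delta>: "admissible_radius M ft x0 \<delta>"
  obtains \<eta> where "\<eta> > 0"
    "\<And>f. f \<in> F_Morse M ft x0 \<delta> \<Longrightarrow> C2_close \<eta> (rball M x0 \<delta>) f ft \<Longrightarrow>
      \<exists>y. crit_points (rball M x0 (2*\<delta>)) f = {y} \<and> morse_index f y = index"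
proof -
  obtain c K where cK: "c > 0" "K \<ge> 1" "\<And>v. c * (norm v)\<^sup>2 \<le> G v v" "\<And>v. norm (L v) \<le> K * norm v"
    using bounds by metis
  \<comment> \<open>Newton's method tolerates a Hessian error of \<open>c / (2 * K)\<close>. Half of
    it is spent on the variation of the Hessian of \<open>ft\<close>, half on the
    perturbation.\<close>
  define \<mu> where "\<mu> = c / (4 * K)"
  have \<mu>: "\<mu> > 0" "2 * \<mu> = c / (2 * K)" "2 * \<mu> \<le> c / 2" using cK(1,2) by (simp_all add: \<mu>_def field_simps)
  obtain r' where r': "r' > 0" "cball x0 r' \<subseteq> M"
    "\<And>x v w. dist x0 x \<le> r' \<Longrightarrow> \<bar>hessian ft x v w - G (L v) w\<bar> \<le> \<mu> * norm v * norm w"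
    using hessian_near[OF \<mu>(1)] by metis
  have \<delta>0: "\<delta> > 0" and ball2: "rball M x0 (2*\<delta>) = cball x0 (2*\<delta>)"
    and crit2: "crit_points (cball x0 (2*\<delta>)) ft = {x0}"
    using \<delta> rball_eq_cball[OF M(1,3), of "2*\<delta>"] by (auto simp: admissible_radius_def)
  have cM: "cball x0 (2*\<delta>) \<subseteq> M" using ball2 by (auto simp: rball_def)
  then have ball1: "rball M x0 \<delta> = cball x0 \<delta>" using \<delta>0 by (auto simp: rball_def)
  define r where "r = min r' \<delta>"
  have r: "r > 0" "r \<le> r'" "r \<le> \<delta>" using r' \<delta>0 by (auto simp: r_def)
  define A where "A = cball x0 \<delta> - ball x0 r"
  \<comment> \<open>The 1-norm of the derivative: bounding each partial derivative by \<eta> bounds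
    it by DIM times \<eta>.\<close>
  define g where "g x = (\<Sum>b\<in>Basis. \<bar>frechet_derivative ft (at x) b\<bar>)" for x
  have AM: "A \<subseteq> M" "A \<subseteq> cball x0 (2*\<delta>)" using cM \<delta>0 by (auto simp: A_def)
  have gpos: "g x > 0" if "x \<in> A" for x
  proof (rule ccontr)
    assume "\<not> g x > 0"
    then have "g x = 0" unfolding g_def by (meson abs_ge_zero antisym_conv not_le sum_nonneg)
    then have z: "frechet_derivative ft (at x) b = 0" if "b \<in> Basis" for b
      using that by (simp add: g_def sum_nonneg_eq_0_iff)
    have "x \<in> M" using that AM by auto
    note lin = smooth_on_linear_derivative[OF M(2) this]
    have "frechet_derivative ft (at x) v = frechet_derivative ft (at x) (\<Sum>b\<in>Basis. (v \<bullet> b) *\<^sub>R b)" for v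
      by (simp add: euclidean_representation)
    then have "frechet_derivative ft (at x) v = 0" for v
      by (simp add: linear_sum[OF lin] linear_scale[OF lin] z)
    then have "x \<in> crit_points (cball x0 (2*\<delta>)) ft"
      using crit_points_iff[OF M(2) \<open>x \<in> M\<close>] that AM by auto
    then show False using crit2 that r by (auto simp: A_def)
  qed
  obtain m where m: "m > 0" "\<And>x. x \<in> A \<Longrightarrow> m \<le> g x"
  proof (cases "A = {}")
    case False
    have "compact A" unfolding A_def by (intro compact_diff compact_cball open_ball)
    moreover have "continuous_on A g"
      unfolding g_def
      by (intro continuous_on_sum continuous_on_rabs
          continuous_on_subset[OF smooth_on_imp_continuous_on[OF smooth_on_directional[OF M(2)]] AM(1)])
    ultimately obtain a where "a \<in> A" "\<And>x. x \<in> A \<Longrightarrow> g a \<le> g x"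
      using continuous_attains_inf[of A g] False by auto
    then show thesis using that gpos by blast
  next
    case True
    then show thesis using that[of 1] by simp
  qed
  \<comment> \<open>The three bounds serve, in this order, the Hessian in the small ball, the first
    Newton step, and the absence of critical points in the shell.\<close>
  define \<eta> where "\<eta> = min (min \<mu> (c * r / (2 * K))) (m / (2 * real DIM('a)))"
  have \<eta>: "\<eta> > 0" "\<eta> \<le> \<mu>" "\<eta> \<le> c * r / (2 * K)" "DIM('a) * \<eta> < m"
  proof -
    show "\<eta> > 0" using \<mu> cK r m by (simp add: \<eta>_def)
    show "\<eta> \<le> \<mu>" "\<eta> \<le> c * r / (2 * K)" by (auto simp: \<eta>_def)
    have "DIM('a) * \<eta> \<le> DIM('a) * (m / (2 * real DIM('a)))" by (intro mult_left_mono) (auto simp: \<eta>_def)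
    also have "\<dots> < m" using m(1) by simp
    finally show "DIM('a) * \<eta> < m" .
  qed
  show thesis
  proof (rule that[OF \<eta>(1)])
    fix f assume F: "f \<in> F_Morse M ft x0 \<delta>" and close: "C2_close \<eta> (rball M x0 \<delta>) f ft"
    have f: "smooth_on M f" and eq: "\<And>x. x \<in> M \<Longrightarrow> x \<notin> cball x0 \<delta> \<Longrightarrow> f x = ft x"
      using F by (auto simp: F_Morse_def ball1)
    have D: "\<bar>frechet_derivative f (at x) v - frechet_derivative ft (at x) v\<bar> \<le> \<eta> * norm v"
      "\<bar>hessian f x v w - hessian ft x v w\<bar> \<le> \<eta> * norm v * norm w" if "x \<in> cball x0 \<delta>" for x v w
    proof -
      have x: "x \<in> M" "x \<in> rball M x0 \<delta>" using that \<delta>0 cM ball1 by auto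
      show "\<bar>frechet_derivative f (at x) v - frechet_derivative ft (at x) v\<bar> \<le> \<eta> * norm v"
        "\<bar>hessian f x v w - hessian ft x v w\<bar> \<le> \<eta> * norm v * norm w"
        by (rule C2_close_scaled[OF M(1) f M(2) x(1) close x(2)])+
    qed
    have hf: "\<bar>hessian f x v w - G (L v) w\<bar> \<le> 2 * \<mu> * norm v * norm w" if "dist x0 x \<le> r" for x v w
    proof -
      have "\<bar>hessian f x v w - hessian ft x v w\<bar> \<le> \<eta> * norm v * norm w" using that r by (intro D) auto
      also have "\<dots> \<le> \<mu> * norm v * norm w" using \<eta> by (intro mult_right_mono) auto
      finally show ?thesis using r'(3)[of x v w] that r by linarith
    qed
    have "\<exists>y. crit_points (cball x0 r) f = {y}"
    proof (rule unique_crit_point_near[OF cK(1,3) _ cK(4) r(1) _ f])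
      show "K > 0" using cK by simp
      show "cball x0 r \<subseteq> M" using r r' by auto
      show "\<bar>hessian f x v w - G (L v) w\<bar> \<le> c / (2 * K) * norm v * norm w" if "dist x0 x \<le> r" for x v w
        using hf[OF that] \<mu>(2) by simp
      show "\<bar>frechet_derivative f (at x0) v\<bar> \<le> c * r / (2 * K) * norm v" for v
        using D(1)[of x0 v] \<delta>0 crit mult_right_mono[OF \<eta>(3) norm_ge_zero[of v]] by auto
    qed
    then obtain y where y: "crit_points (cball x0 r) f = {y}" by blast
    have "x \<in> cball x0 r" if "x \<in> crit_points (cball x0 (2*\<delta>)) f" for x
    proof (rule ccontr)
      assume nx: "x \<notin> cball x0 r"
      have x: "x \<in> cball x0 (2*\<delta>)" "x \<in> M" using that cM by (auto simp: crit_points_def)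
      have z: "frechet_derivative f (at x) v = 0" for v using that crit_points_iff[OF f x(2)] by blast
      show False
      proof (cases "x \<in> cball x0 \<delta>")
        case True
        then have "x \<in> A" using nx by (auto simp: A_def)
        have "g x \<le> (\<Sum>b\<in>(Basis::'a set). \<eta>)"
          unfolding g_def
        proof (rule sum_mono)
          fix b :: 'a assume "b \<in> Basis"
          then show "\<bar>frechet_derivative ft (at x) b\<bar> \<le> \<eta>" using D(1)[OF True, of b] by (simp add: z)
        qed
        then show False using m(2)[OF \<open>x \<in> A\<close>] \<eta>(4) by simp
      next
        case False
        have "(f has_derivative (\<lambda>v. 0)) (at x)" using that by (simp add: crit_points_def)
        then have "(ft has_derivative (\<lambda>v. 0)) (at x)"
          by (rule has_derivative_transform_within_open[where s="M - cball x0 \<delta>"])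
            (use M(1) x False eq in auto)
        then have "x \<in> crit_points (cball x0 (2*\<delta>)) ft" using x by (simp add: crit_points_def)
        then show False using crit2 False \<delta>0 by auto
      qed
    qed
    then have "crit_points (cball x0 (2*\<delta>)) f = crit_points (cball x0 r) f"
      using r \<delta>0 by (auto simp: crit_points_def)
    moreover have "morse_index f y = index"
    proof (rule morse_index_near[OF cK(1,3)])
      fix v
      have "dist x0 y \<le> r" using y by (auto simp: crit_points_def)
      then have "\<bar>hessian f y v v - G (L v) v\<bar> \<le> 2 * \<mu> * norm v * norm v" by (rule hf)
      also have "\<dots> \<le> c / 2 * norm v * norm v" using \<mu>(3) by (intro mult_right_mono) auto
      finally show "\<bar>hessian f y v v - G (L v) v\<bar> \<le> c / 2 * norm v * norm v" .
    qed
    ultimately show "\<exists>y. crit_points (rball M x0 (2*\<delta>)) f = {y} \<and> morse_index f y = index"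
      using y ball2 by auto
  qed
qed

text \<open>Newton's method applied to \<open>ft\<close> itself isolates \<open>x0\<close> in a ball
  of radius \<open>r\<close>; the radius is halved because admissibility concerns the ball of radius
  2\<delta>.\<close>

lemma admissible_radius_exists: "\<exists>\<delta>. admissible_radius M ft x0 \<delta>"
proof -
  obtain c K where cK: "c > 0" "K \<ge> 1" "\<And>v. c * (norm v)\<^sup>2 \<le> G v v" "\<And>v. norm (L v) \<le> K * norm v"
    using bounds by metis
  then have K: "K > 0" by simp
  then have "c / (2 * K) > 0" using cK by simp
  then obtain r where r: "r > 0" "cball x0 r \<subseteq> M"
    "\<And>x v w. dist x0 x \<le> r \<Longrightarrow> \<bar>hessian ft x v w - G (L v) w\<bar> \<le> c / (2 * K) * norm v * norm w"
    using hessian_near by metis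
  obtain y where y: "crit_points (cball x0 r) ft = {y}"
    using unique_crit_point_near[OF cK(1,3) K cK(4) r(1,2) M(2) r(3)] crit cK r(1) K by auto
  have "x0 \<in> crit_points (cball x0 r) ft" using crit_points_iff[OF M(2,3)] crit r by auto
  then have "crit_points (cball x0 r) ft = {x0}" using y by auto
  moreover have "rball M x0 r = cball x0 r" using r by (auto simp: rball_def)
  ultimately have "admissible_radius M ft x0 (r/2)" using r by (simp add: admissible_radius_def)
  then show ?thesis ..
qed

text \<open>Differentiating the Riesz representation of the gradient gives the Riesz vector of the
  Hessian, which \<open>hess\<close> and self-adjointness identify with \<open>L w\<close>.\<close>

lemma gradient_derivative: "frechet_derivative (gradient (\<lambda>x. G) ft) (at x0) = L"
proof -
  obtain R where R: "linear R" "\<And>u v. G (R u) v = u \<bullet> v" using riesz by metis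
  have "((\<lambda>x. R (\<Sum>b\<in>Basis. frechet_derivative ft (at x) b *\<^sub>R b)) has_derivative
      (\<lambda>w. R (\<Sum>b\<in>Basis. hessian ft x0 b w *\<^sub>R b))) (at x0)"
    using R(1)
    by (intro bounded_linear.has_derivative[of R] has_derivative_sum has_derivative_scaleR_left
        smooth_on_has_derivative_hessian[OF M(2,3)]) (simp add: linear_linear)
  moreover have "R (\<Sum>b\<in>Basis. hessian ft x0 b w *\<^sub>R b) = L w" for w
  proof -
    have "R (\<Sum>b\<in>Basis. hessian ft x0 b w *\<^sub>R b) - L w = 0"
    proof (rule nondegenerate)
      fix v
      have "G (R (\<Sum>b\<in>Basis. hessian ft x0 b w *\<^sub>R b)) v = (\<Sum>b\<in>Basis. G (L w) b * (b \<bullet> v))"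
        by (simp add: R(2) inner_sum_left hess self_adjoint sym[of _ "L w"])
      also have "\<dots> = G (L w) (\<Sum>b\<in>Basis. (v \<bullet> b) *\<^sub>R b)"
      proof -
        have "linear (G (L w))" using bilinear by (simp add: bilinear_def)
        then show ?thesis
          by (simp add: linear_sum[of "G (L w)"] linear_scale[of "G (L w)"] inner_commute[of v] mult.commute)
      qed
      finally show "G (R (\<Sum>b\<in>Basis. hessian ft x0 b w *\<^sub>R b) - L w) v = 0"
        by (simp add: bilinear_lsub[OF bilinear] euclidean_representation)
    qed
    then show ?thesis by simp
  qed
  ultimately have "((\<lambda>x. R (\<Sum>b\<in>Basis. frechet_derivative ft (at x) b *\<^sub>R b)) has_derivative L) (at x0)"
    by simp
  then have "(gradient (\<lambda>x. G) ft has_derivative L) (at x0)"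
    by (rule has_derivative_transform_within_open[OF _ M(1,3)]) (simp add: gradient_eq[OF R(2) M(2)])
  then show ?thesis by (rule frechet_derivative_at[symmetric])
qed

text \<open>Two metrics are involved: flow lines of the flat metric in all of \<open>M\<close> must
  stay in the ball, and those of \<open>G\<close> in the ball must be regular. Both kinds start and
  end at \<open>x0\<close>, so both are constant.\<close>

lemma unperturbed_Morse_Smale_pair:
  assumes \<delta>: "admissible_radius M ft x0 \<delta>" and \<eta>: "\<eta> > 0"
  shows "local_Morse_Smale_pair M ft x0 \<delta> \<eta> ft (\<lambda>x. G)"
proof -
  have crit2: "crit_points (rball M x0 (2*\<delta>)) ft = {x0}" and \<delta>0: "\<delta> > 0"
    using \<delta> by (auto simp: admissible_radius_def)
  have "crit_points (rball M x0 \<delta>) ft = crit_points (rball M x0 (2*\<delta>)) ft \<inter> rball M x0 \<delta>"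
    using \<delta>0 by (auto simp: crit_points_def rball_def)
  then have crit1: "crit_points (rball M x0 \<delta>) ft = {x0}"
    unfolding crit2 using M(3) \<delta>0 by (auto simp: rball_def)
  have "nondegenerate_at ft x0"
    unfolding nondegenerate_at_def hess
    using nondegenerate L(2) linear_0[OF L(1)] by metis
  then have "ft \<in> F_Morse M ft x0 \<delta>" using M(2) crit1 by (auto simp: F_Morse_def)
  moreover have "C2_close \<eta> S ft ft" for S using \<eta> by (simp add: C2_close_def)
  moreover have "range x \<subseteq> rball M x0 (2*\<delta>)" if "x \<in> flow_lines M ft flat_metric x0 x0" for x
    using flat.closed_flow_line_const[OF M(2) _ M(1,3) that] M(3) \<delta>0 by (auto simp: rball_def)
  ultimately have "ft \<in> F_Morse_local M ft x0 \<delta> \<eta>" using crit1 by (auto simp: F_Morse_local_def)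
  moreover have "riemannian_metric_on S (\<lambda>x. G)" for S
    unfolding riemannian_metric_on_def
    by (rule exI[of _ UNIV]) (auto simp: smooth_on_const bilinear pos intro: sym)
  moreover have "linearization_surj ft (\<lambda>x. G) x" if "x \<in> flow_lines (rball M x0 (2*\<delta>)) ft (\<lambda>x. G) x0 x0" for x
  proof -
    have "x s = x0" for s
      by (rule closed_flow_line_const[OF M(2) _ M(1,3) that]) (auto simp: rball_def)
    then have x: "x = (\<lambda>s. x0)" by (rule ext)
    show ?thesis
      unfolding linearization_surj_def x gradient_derivative
    proof
      fix z :: "real \<Rightarrow> 'a" assume "z \<in> L2"
      from L2_solution_involution[OF this L(1,2)]
      obtain u u' where "u \<in> L2" "u' \<in> L2" "weak_derivative u u'" "\<And>s. u' s + L (u s) = z s" by metis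
      then show "\<exists>u\<in>L2. \<exists>u'\<in>L2. weak_derivative u u' \<and> (AE s in lborel. u' s + L (u s) = z s)"
        by (intro bexI[of _ u] bexI[of _ u'] conjI AE_I2)
    qed
  qed
  ultimately show ?thesis using crit2 by (auto simp: local_Morse_Smale_pair_def)
qed

end

section \<open>Homology with a single generator\<close>

lemma CM_group: "group (CM B f k)"
proof (rule groupI)
  fix c assume "c \<in> carrier (CM B f k)"
  \<comment> \<open>Over the field with two elements every chain is its own inverse.\<close>
  then show "\<exists>d\<in>carrier (CM B f k). d \<otimes>\<^bsub>CM B f k\<^esub> c = \<one>\<^bsub>CM B f k\<^esub>"
    by (intro bexI[of _ c]) (auto simp: CM_def fun_eq_iff)
next
  fix c d assume cd: "c \<in> carrier (CM B f k)" "d \<in> carrier (CM B f k)"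
  have "{x. c x + d x \<noteq> 0} \<subseteq> {x. c x \<noteq> 0} \<union> {x. d x \<noteq> 0}" by auto
  with cd show "c \<otimes>\<^bsub>CM B f k\<^esub> d \<in> carrier (CM B f k)"
    by (auto simp: CM_def intro: finite_subset)
next
  fix c d e
  show "c \<otimes>\<^bsub>CM B f k\<^esub> d \<otimes>\<^bsub>CM B f k\<^esub> e = c \<otimes>\<^bsub>CM B f k\<^esub> (d \<otimes>\<^bsub>CM B f k\<^esub> e)"
    by (simp only: CM_def monoid.simps add.assoc)
qed (auto simp: CM_def)

lemma HM_iso_CM:
  assumes "\<And>j c. c \<in> carrier (CM B f j) \<Longrightarrow> boundary B f g c = (\<lambda>x. 0)"
  shows "HM B f g k \<cong> CM B f k"
proof -
  interpret group "CM B f k" by (rule CM_group)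
  have one: "\<one>\<^bsub>CM B f j\<^esub> = (\<lambda>x. 0)" for j by (simp add: CM_def)
  have "kernel (CM B f k) (CM B f (k - 1)) (boundary B f g) = carrier (CM B f k)"
    using assms by (auto simp: kernel_def one)
  moreover have "boundary B f g ` carrier (CM B f (k + 1)) = {\<one>\<^bsub>CM B f k\<^esub>}"
    using assms[of _ "k + 1"] group.is_monoid[OF CM_group[of B f "k + 1"], THEN monoid.one_closed]
    by (force simp: one)
  ultimately have "HM B f g k = CM B f k Mod {\<one>\<^bsub>CM B f k\<^esub>}" by (simp add: HM_def)
  then show ?thesis using trivial_factor_iso is_isoI by metis
qed

text \<open>The differential sums over pairs of critical points whose indices differ by 1. A lone
  point forms no such pair, so the sum is zero without any count of flow lines, for every
  metric.\<close>

lemma HM_single_crit_point: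
  assumes crit: "crit_points B f = {y}"
  shows "HM B f g k \<cong> (if k = int (morse_index f y) then integer_mod_group 2 else singleton_group 0)"
proof -
  have supp: "{x. c x \<noteq> 0} \<subseteq> {y}" if "c \<in> carrier (CM B f j)" for c j
    using that crit by (auto simp: CM_def)
  have "HM B f g k \<cong> CM B f k"
  proof (rule HM_iso_CM)
    fix j c assume "c \<in> carrier (CM B f j)"
    from supp[OF this] crit show "boundary B f g c = (\<lambda>x. 0)"
      by (auto simp: boundary_def fun_eq_iff intro!: sum.neutral)
  qed
  also have "CM B f k \<cong> (if k = int (morse_index f y) then integer_mod_group 2 else singleton_group 0)"
  proof (cases "k = int (morse_index f y)")
    case True
    define h where "h c = (if c y = 0 then 0 else 1 :: int)" for c :: "'a \<Rightarrow> bit"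
    have ext: "c = d" if "c \<in> carrier (CM B f k)" "d \<in> carrier (CM B f k)" "c y = d y" for c d
    proof
      fix x show "c x = d x"
      proof (cases "x = y")
        case False
        then have "c x = 0" "d x = 0" using supp[OF that(1)] supp[OF that(2)] by blast+
        then show ?thesis by simp
      qed (use that(3) in simp)
    qed
    have "h \<in> hom (CM B f k) (integer_mod_group 2)"
      by (auto simp: hom_def h_def integer_mod_group_def CM_def)
    moreover have "inj_on h (carrier (CM B f k))"
      by (intro inj_onI ext) (auto simp: h_def split: if_splits)
    moreover have "h ` carrier (CM B f k) = carrier (integer_mod_group 2)"
    proof -
      have "(\<lambda>x. 0) \<in> carrier (CM B f k)" "(\<lambda>x. if x = y then 1 else 0) \<in> carrier (CM B f k)"
        using crit True by (auto simp: CM_def)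
      then have "{h (\<lambda>x. 0), h (\<lambda>x. if x = y then 1 else 0)} \<subseteq> h ` carrier (CM B f k)" by blast
      moreover have "h (\<lambda>x. 0) = 0" "h (\<lambda>x. if x = y then 1 else 0) = 1" by (simp_all add: h_def)
      ultimately have "{0, 1} \<subseteq> h ` carrier (CM B f k)" by (simp only:)
      moreover have "h ` carrier (CM B f k) \<subseteq> {0, 1}" by (simp add: h_def image_subset_iff)
      moreover have "carrier (integer_mod_group 2) = {0, 1}" by (auto simp: carrier_integer_mod_group)
      ultimately show ?thesis by (simp only: subset_antisym)
    qed
    ultimately show ?thesis using True by (auto intro!: is_isoI isoI simp: bij_betw_def)
  next
    case False
    then have "{x \<in> crit_points B f. int (morse_index f x) = k} = {}" using crit by auto
    then have "carrier (CM B f k) = {\<lambda>x. 0}" by (auto simp: CM_def fun_eq_iff simp del: bit_not_zero_iff)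
    then have "(\<lambda>c. 0) \<in> iso (CM B f k) (singleton_group 0)"
      by (auto simp: iso_def hom_def bij_betw_def singleton_group_def)
    then show ?thesis using False is_isoI by auto
  qed
  finally (iso_trans) show ?thesis .
qed

lemma (in nondegenerate_critical_point) local_Morse_homology:
  "has_local_Morse_homology M ft x0 (\<lambda>k. if k = int index then integer_mod_group 2 else singleton_group 0)"
  unfolding has_local_Morse_homology_def
proof (intro conjI allI impI)
  fix \<delta> assume \<delta>: "admissible_radius M ft x0 \<delta>"
  show "\<exists>f g. local_Morse_Smale_pair M ft x0 \<delta> \<eta> f g" if "\<eta> > 0" for \<eta>
    using unperturbed_Morse_Smale_pair[OF \<delta> that] by blast
  obtain \<eta> where \<eta>: "\<eta> > 0"
    "\<And>f. f \<in> F_Morse M ft x0 \<delta> \<Longrightarrow> C2_close \<eta> (rball M x0 \<delta>) f ft \<Longrightarrow>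
      \<exists>y. crit_points (rball M x0 (2*\<delta>)) f = {y} \<and> morse_index f y = index"
    using perturbed_crit_points[OF \<delta>] by metis
  show "\<exists>\<eta>>0. \<forall>f g. local_Morse_Smale_pair M ft x0 \<delta> \<eta> f g \<longrightarrow>
      (\<forall>k. HM (rball M x0 (2*\<delta>)) f g k \<cong> (if k = int index then integer_mod_group 2 else singleton_group 0))"
  proof (intro exI[of _ \<eta>] conjI allI impI)
    fix f g k assume "local_Morse_Smale_pair M ft x0 \<delta> \<eta> f g"
    then have "f \<in> F_Morse M ft x0 \<delta>" "C2_close \<eta> (rball M x0 \<delta>) f ft"
      by (auto simp: local_Morse_Smale_pair_def F_Morse_local_def)
    from \<eta>(2)[OF this] obtain y where y: "crit_points (rball M x0 (2*\<delta>)) f = {y}" "morse_index f y = index"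
      by blast
    show "HM (rball M x0 (2*\<delta>)) f g k \<cong> (if k = int index then integer_mod_group 2 else singleton_group 0)"
      using HM_single_crit_point[OF y(1), of g k] unfolding y(2) .
  qed (rule \<eta>(1))
qed (rule admissible_radius_exists)

section \<open>The Lagrange potential\<close>

lemma Ck_on_cong:
  assumes "open S" "\<And>x. x \<in> S \<Longrightarrow> f x = g x" "Ck_on k S f"
  shows "Ck_on k S g"
  using assms(2,3)
proof (induction k arbitrary: f g)
  case 0
  then show ?case using continuous_on_cong by auto
next
  case (Suc k)
  have d: "(g has_derivative frechet_derivative f (at x)) (at x)" if "x \<in> S" for x
  proof (rule has_derivative_transform_within_open[OF _ assms(1) that Suc.prems(1)])
    show "(f has_derivative frechet_derivative f (at x)) (at x)"
      using Suc.prems(2) that by (simp add: frechet_derivative_works)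
  qed
  show ?case
  proof (simp, intro conjI ballI allI)
    show "g differentiable (at x)" if "x \<in> S" for x using d[OF that] differentiableI by blast
    show "Ck_on k S (\<lambda>x. frechet_derivative g (at x) v)" for v
      by (rule Suc.IH[of "\<lambda>x. frechet_derivative f (at x) v"])
        (use Suc.prems(2) in \<open>auto simp: frechet_derivative_at[OF d, symmetric]\<close>)
  qed
qed

text \<open>A family that contains the directional derivatives of its members consists of smooth
  functions, by induction on the order of differentiability.\<close>

lemma smooth_on_coinduct:
  assumes "open S" "f \<in> F"
    and deriv: "\<And>f. f \<in> F \<Longrightarrow> \<exists>D. (\<forall>v. D v \<in> F) \<and> (\<forall>x\<in>S. (f has_derivative (\<lambda>v. D v x)) (at x))"
  shows "smooth_on S f"
proof -
  have "Ck_on k S f" if "f \<in> F" for k f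
    using that
  proof (induction k arbitrary: f)
    case 0
    obtain D where "\<And>x. x \<in> S \<Longrightarrow> (f has_derivative (\<lambda>v. D v x)) (at x)" using deriv[OF 0] by blast
    then show ?case
      by (auto intro!: continuous_at_imp_continuous_on has_derivative_continuous)
  next
    case (Suc k)
    obtain D where D: "\<And>v. D v \<in> F" "\<And>x. x \<in> S \<Longrightarrow> (f has_derivative (\<lambda>v. D v x)) (at x)"
      using deriv[OF Suc.prems] by blast
    have "Ck_on k S (\<lambda>x. frechet_derivative f (at x) v)" for v
      by (rule Ck_on_cong[OF assms(1) _ Suc.IH[OF D(1)[of v]]])
        (simp add: frechet_derivative_at[OF D(2), symmetric])
    then show ?case using D(2) differentiableI by (simp, blast)
  qed
  then show ?thesis using assms(2) by (simp add: smooth_on_def)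
qed

lemma has_derivative_inverse_norm:
  fixes p q :: "'a::real_inner"
  assumes "q \<noteq> p"
  shows "((\<lambda>q. inverse (norm (q - p))) has_derivative (\<lambda>v. - (inverse (norm (q - p)) ^ 3) * ((q - p) \<bullet> v))) (at q)"
proof -
  have "((\<lambda>q. norm (q - p)) has_derivative (\<lambda>v. sgn (q - p) \<bullet> v)) (at q)"
  proof -
    have "((\<lambda>q. q - p) has_derivative (\<lambda>v. v)) (at q)" by (auto intro!: derivative_eq_intros)
    from has_derivative_compose[OF this has_derivative_norm] assms
    show ?thesis by (simp add: inner_commute)
  qed
  from Deriv.has_derivative_inverse[OF _ this] assms
  show ?thesis by (simp add: sgn_div_norm power3_eq_cube mult_ac)
qed

text \<open>An algebra containing the potential and closed under directional derivatives:
  differentiating an inverse distance gives its cube times an affine function.\<close>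

inductive_set newton_functions :: "'a::real_inner set \<Rightarrow> ('a \<Rightarrow> real) set" for P where
  const: "(\<lambda>q. c) \<in> newton_functions P"
| lin: "(\<lambda>q. q \<bullet> v) \<in> newton_functions P"
| quad: "(\<lambda>q. q \<bullet> q) \<in> newton_functions P"
| inverse_norm: "p \<in> P \<Longrightarrow> (\<lambda>q. inverse (norm (q - p))) \<in> newton_functions P"
| add: "f \<in> newton_functions P \<Longrightarrow> g \<in> newton_functions P \<Longrightarrow> (\<lambda>q. f q + g q) \<in> newton_functions P"
| mult: "f \<in> newton_functions P \<Longrightarrow> g \<in> newton_functions P \<Longrightarrow> (\<lambda>q. f q * g q) \<in> newton_functions P"

lemma newton_functions_deriv:
  assumes "f \<in> newton_functions P"
  shows "\<exists>D. (\<forall>v. D v \<in> newton_functions P) \<and> (\<forall>x\<in>-P. (f has_derivative (\<lambda>v. D v x)) (at x))"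
  using assms
proof induction
  case (const c)
  show ?case by (rule exI[of _ "\<lambda>v x. 0"]) (auto intro: newton_functions.const)
next
  case (lin w)
  show ?case
    by (rule exI[of _ "\<lambda>v x. v \<bullet> w"]) (auto intro!: newton_functions.const derivative_eq_intros)
next
  case quad
  show ?case
  proof (rule exI[of _ "\<lambda>v x. 2 * (x \<bullet> v)"], intro conjI allI ballI)
    show "(\<lambda>x. 2 * (x \<bullet> v)) \<in> newton_functions P" for v by (intro newton_functions.intros)
    show "((\<lambda>q. q \<bullet> q) has_derivative (\<lambda>v. 2 * (x \<bullet> v))) (at x)" for x
      by (auto intro!: derivative_eq_intros simp: inner_commute)
  qed
next
  case (inverse_norm p)
  let ?i = "\<lambda>x. inverse (norm (x - p))"
  show ?case
  proof (rule exI[of _ "\<lambda>v x. -1 * (?i x * (?i x * ?i x)) * (x \<bullet> v + - (p \<bullet> v))"], intro conjI allI ballI)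
    show "(\<lambda>x. -1 * (?i x * (?i x * ?i x)) * (x \<bullet> v + - (p \<bullet> v))) \<in> newton_functions P" for v
      using inverse_norm by (intro newton_functions.intros)
    fix x assume "x \<in> - P"
    then have "x \<noteq> p" using inverse_norm by auto
    from has_derivative_inverse_norm[OF this]
    show "(?i has_derivative (\<lambda>v. -1 * (?i x * (?i x * ?i x)) * (x \<bullet> v + - (p \<bullet> v)))) (at x)"
      by (simp add: power3_eq_cube inner_diff_left mult.assoc)
  qed
next
  case (add f g)
  then obtain D E where D: "\<And>v. D v \<in> newton_functions P" "\<And>x. x \<in> -P \<Longrightarrow> (f has_derivative (\<lambda>v. D v x)) (at x)"
    and E: "\<And>v. E v \<in> newton_functions P" "\<And>x. x \<in> -P \<Longrightarrow> (g has_derivative (\<lambda>v. E v x)) (at x)"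
    by metis
  show ?case
    by (rule exI[of _ "\<lambda>v x. D v x + E v x"]) (intro conjI allI ballI newton_functions.add has_derivative_add D E)
next
  case (mult f g)
  then obtain D E where D: "\<And>v. D v \<in> newton_functions P" "\<And>x. x \<in> -P \<Longrightarrow> (f has_derivative (\<lambda>v. D v x)) (at x)"
    and E: "\<And>v. E v \<in> newton_functions P" "\<And>x. x \<in> -P \<Longrightarrow> (g has_derivative (\<lambda>v. E v x)) (at x)"
    by metis
  show ?case
    by (rule exI[of _ "\<lambda>v x. f x * E v x + D v x * g x"])
      (intro conjI allI ballI newton_functions.intros has_derivative_mult D E mult)
qed

lemma smooth_on_newton_functions:
  assumes "finite P" "f \<in> newton_functions P"
  shows "smooth_on (- P) f"
  by (rule smooth_on_coinduct[OF open_Compl[OF finite_imp_closed[OF assms(1)]] assms(2) newton_functions_deriv])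

section \<open>The potential and its first two derivatives\<close>

definition pole1 :: "real^2" where "pole1 = vector [-1/2, 0]"
definition pole2 :: "real^2" where "pole2 = vector [1/2, 0]"

lemma norm_vec2: "norm (x :: real^2) = sqrt ((x$1)\<^sup>2 + (x$2)\<^sup>2)"
  by (simp add: norm_vec_def L2_set_def sum_2)

lemma inner_vec2: "(x :: real^2) \<bullet> y = x$1 * y$1 + x$2 * y$2"
  by (simp add: inner_vec_def sum_2)

lemma vec2_eq_iff: "(x :: real^2) = y \<longleftrightarrow> x$1 = y$1 \<and> x$2 = y$2"
  by (simp add: vec_eq_iff forall_2)

lemma lagrange_domain_eq: "lagrange_domain = - {pole1, pole2}"
  by (auto simp: lagrange_domain_def pole1_def pole2_def)

lemma open_lagrange_domain: "open lagrange_domain"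
  by (simp add: lagrange_domain_eq open_Compl finite_imp_closed)

lemma pole_nth [simp]: "pole1$1 = -1/2" "pole1$2 = 0" "pole2$1 = 1/2" "pole2$2 = 0"
  by (simp_all add: pole1_def pole2_def)

lemma minus_pole_nth [simp]:
  "(q - pole1)$1 = q$1 + 1/2" "(q - pole1)$2 = q$2" "(q - pole2)$1 = q$1 - 1/2" "(q - pole2)$2 = q$2"
  by simp_all

lemma norm_minus_pole:
  "norm (q - pole1) = sqrt ((q$1 + 1/2)\<^sup>2 + (q$2)\<^sup>2)" "norm (q - pole2) = sqrt ((q$1 - 1/2)\<^sup>2 + (q$2)\<^sup>2)"
  by (simp_all only: norm_vec2 minus_pole_nth)

lemma lagrange_V_eq:
  "lagrange_V m1 m2 \<epsilon> = (\<lambda>q. - m1 * inverse (norm (q - pole1)) + - m2 * inverse (norm (q - pole2)) + - (\<epsilon>/2) * (q \<bullet> q))"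
proof
  fix q :: "real^2"
  have "- (m1 / a + m2 / b + \<epsilon>/2 * c) = - m1 * inverse a + - m2 * inverse b + - (\<epsilon>/2) * c" for a b c
    by (simp add: divide_inverse[of m1] divide_inverse[of m2])
  then show "lagrange_V m1 m2 \<epsilon> q = - m1 * inverse (norm (q - pole1)) + - m2 * inverse (norm (q - pole2)) + - (\<epsilon>/2) * (q \<bullet> q)"
    unfolding lagrange_V_def lagrange_U_def norm_minus_pole power2_norm_eq_inner .
qed

lemma smooth_lagrange_V: "smooth_on lagrange_domain (lagrange_V m1 m2 \<epsilon>)"
  unfolding lagrange_V_eq lagrange_domain_eq
  by (intro smooth_on_newton_functions newton_functions.intros) auto

lemma frechet_derivative_lagrange_V:
  assumes "q \<in> lagrange_domain"
  shows "frechet_derivative (lagrange_V m1 m2 \<epsilon>) (at q) v =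
    m1 * inverse (norm (q - pole1))^3 * ((q - pole1) \<bullet> v)
    + m2 * inverse (norm (q - pole2))^3 * ((q - pole2) \<bullet> v) - \<epsilon> * (q \<bullet> v)"
proof -
  have q: "q \<noteq> pole1" "q \<noteq> pole2" using assms by (auto simp: lagrange_domain_eq)
  have "(lagrange_V m1 m2 \<epsilon> has_derivative (\<lambda>v. m1 * inverse (norm (q - pole1))^3 * ((q - pole1) \<bullet> v)
    + m2 * inverse (norm (q - pole2))^3 * ((q - pole2) \<bullet> v) - \<epsilon> * (q \<bullet> v))) (at q)"
    unfolding lagrange_V_eq
    by (rule derivative_eq_intros has_derivative_inverse_norm q refl)+
      (simp add: fun_eq_iff inner_commute)
  then show ?thesis by (simp add: frechet_derivative_at[symmetric])
qed

lemma hessian_lagrange_V: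
  assumes "q \<in> lagrange_domain"
  shows "hessian (lagrange_V m1 m2 \<epsilon>) q v w =
    (m1 * inverse (norm (q - pole1))^3 + m2 * inverse (norm (q - pole2))^3 - \<epsilon>) * (v \<bullet> w)
    - 3 * m1 * inverse (norm (q - pole1))^5 * ((q - pole1) \<bullet> v) * ((q - pole1) \<bullet> w)
    - 3 * m2 * inverse (norm (q - pole2))^5 * ((q - pole2) \<bullet> v) * ((q - pole2) \<bullet> w)"
proof -
  have q: "q \<noteq> pole1" "q \<noteq> pole2" using assms by (auto simp: lagrange_domain_eq)
  show ?thesis
    by (rule hessian_eqI[OF open_lagrange_domain assms frechet_derivative_lagrange_V])
      (assumption, (rule derivative_eq_intros has_derivative_inverse_norm q refl)+,
        simp add: fun_eq_iff algebra_simps inner_commute eval_nat_numeral)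
qed

section \<open>Equilibria of the Lagrange problem\<close>

lemma dim_first_axis: "dim {v :: real^2. v$2 = 0} = 1"
proof -
  have "{v :: real^2. v$2 = 0} = span {axis 1 1}"
    by (auto simp: span_singleton vec2_eq_iff axis_def)
  then show ?thesis by (simp add: dim_singleton)
qed

lemma weighted_squares_pos:
  fixes a b x y :: real
  assumes "a > 0" "b > 0" "x \<noteq> 0 \<or> y \<noteq> 0"
  shows "a * (x * x) + b * (y * y) > 0"
proof -
  have "a * (x * x) > 0 \<or> b * (y * y) > 0"
    using assms by (metis mult_pos_pos not_real_square_gt_zero)
  moreover have "a * (x * x) \<ge> 0" "b * (y * y) \<ge> 0" using assms by simp_all
  ultimately show ?thesis by linarith
qed

text \<open>The expression is the signed inverse square force of a unit pole on a line;
  \<open>s * t > 0\<close> places both points on the same side of the pole.\<close>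

lemma inverse_square_decreasing:
  fixes s t :: real
  assumes "s < t" "s * t > 0"
  shows "t * inverse \<bar>t\<bar> ^ 3 < s * inverse \<bar>s\<bar> ^ 3"
proof -
  have *: "t * inverse \<bar>t\<bar> ^ 3 < s * inverse \<bar>s\<bar> ^ 3" if "0 < s" "s < t" for s t :: real
  proof -
    have "x * inverse \<bar>x\<bar> ^ 3 = inverse (x * x)" if "x > 0" for x :: real
      using that by (simp add: power3_eq_cube field_simps)
    then show ?thesis using that by (simp add: mult_strict_mono)
  qed
  show ?thesis
  proof (cases "s > 0")
    case False
    then have "t < 0" using assms by (smt (verit) zero_less_mult_iff)
    then show ?thesis using *[of "-t" "-s"] assms by simp
  qed (use * assms in blast)
qed

text \<open>With \<open>A = (\<rho>1/r1)^3\<close> and \<open>B = (\<rho>2/r2)^3\<close> the hypothesis \<open>eq\<close> is the equation of a collinear critical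
  point at signed distances \<open>s\<close> and \<open>s - 1\<close> from the poles, and \<open>\<rho>1, \<rho>2\<close> are the distances from the
  poles of a critical point off the axis.\<close>

lemma triangle_imp_saddle:
  fixes s \<rho>1 \<rho>2 :: real
  defines "A \<equiv> (\<rho>1 / \<bar>s\<bar>) ^ 3" and "B \<equiv> (\<rho>2 / \<bar>s - 1\<bar>) ^ 3"
  assumes s: "s \<noteq> 0" "s \<noteq> 1" and \<rho>: "\<rho>1 > 0" "\<rho>2 > 0"
    and tri: "\<rho>1 + \<rho>2 > 1" "\<rho>1 < 1 + \<rho>2" "\<rho>2 < 1 + \<rho>1"
    and eq: "(A - 1) * s + (B - 1) * (s - 1) = 0"
  shows "A + B > 2"
proof (rule ccontr)
  assume "\<not> A + B > 2"
  then have le: "(A - 1) + (B - 1) \<le> 0" by simp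
  have cube: "(x / y) ^ 3 \<le> 1 \<longleftrightarrow> x \<le> y" "(x / y) ^ 3 \<ge> 1 \<longleftrightarrow> x \<ge> y" if "x > 0" "y > 0" for x y :: real
  proof -
    have "(x / y) ^ 3 \<le> 1 ^ 3 \<longleftrightarrow> x / y \<le> 1" "1 ^ 3 \<le> (x / y) ^ 3 \<longleftrightarrow> 1 \<le> x / y"
      using that by (intro power_mono_iff; simp)+
    then show "(x / y) ^ 3 \<le> 1 \<longleftrightarrow> x \<le> y" "(x / y) ^ 3 \<ge> 1 \<longleftrightarrow> x \<ge> y" using that by simp_all
  qed
  have A: "A \<le> 1 \<longleftrightarrow> \<rho>1 \<le> \<bar>s\<bar>" "A \<ge> 1 \<longleftrightarrow> \<rho>1 \<ge> \<bar>s\<bar>"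
    unfolding A_def by (intro cube; use \<rho> s in simp)+
  have B: "B \<le> 1 \<longleftrightarrow> \<rho>2 \<le> \<bar>s - 1\<bar>" "B \<ge> 1 \<longleftrightarrow> \<rho>2 \<ge> \<bar>s - 1\<bar>"
    unfolding B_def by (intro cube; use \<rho> s in simp)+
  \<comment> \<open>Solving \<open>eq\<close> in terms of the sum \<open>A + B - 2\<close> shows
    that its sign and the position of \<open>s\<close> determine the signs of \<open>A - 1\<close>
    and \<open>B - 1\<close>. On each of the three intervals these contradict one of the three
    triangle inequalities.\<close>
  have eqA: "A - 1 = ((A - 1) + (B - 1)) * (1 - s)" and eqB: "B - 1 = ((A - 1) + (B - 1)) * s"
    using eq by (simp_all add: algebra_simps)
  consider "s < 0" | "0 < s" "s < 1" | "s > 1" using s by linarith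
  then show False
  proof cases
    case 1
    have "A - 1 \<le> 0" using eqA le 1 by (metis diff_ge_0_iff_ge less_imp_le mult_nonpos_nonneg order_trans zero_le_one)
    moreover have "B - 1 \<ge> 0" using eqB le 1 by (metis less_imp_le mult_nonpos_nonpos)
    ultimately show False using A B tri 1 by simp
  next
    case 2
    have "A - 1 \<le> 0" using eqA le 2 by (metis diff_ge_0_iff_ge less_imp_le mult_nonpos_nonneg)
    moreover have "B - 1 \<le> 0" using eqB le 2 by (metis less_imp_le mult_nonpos_nonneg)
    ultimately show False using A B tri 2 by simp
  next
    case 3
    have "A - 1 \<ge> 0" using eqA le 3 by (metis diff_le_0_iff_le less_imp_le mult_nonpos_nonpos)
    moreover have "B - 1 \<le> 0" using eqB le 3 by (metis less_imp_le less_trans mult_nonpos_nonneg zero_less_one)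
    ultimately show False using A B tri 3 by simp
  qed
qed

section \<open>Types and number of the critical points\<close>

context
  fixes m1 m2 \<epsilon> :: real
  assumes m1: "m1 > 0" and m2: "m2 > 0" and \<epsilon>: "\<epsilon> > 0"
begin

abbreviation (input) "V \<equiv> lagrange_V m1 m2 \<epsilon>"

text \<open>The coefficient of \<open>q - pole1\<close> in the gradient of \<open>V\<close>, that
  is, force per unit of distance.\<close>

definition "attraction1 q = m1 * inverse (norm (q - pole1)) ^ 3"
definition "attraction2 q = m2 * inverse (norm (q - pole2)) ^ 3"

lemma attraction_pos: "q \<in> lagrange_domain \<Longrightarrow> attraction1 q > 0" "q \<in> lagrange_domain \<Longrightarrow> attraction2 q > 0"
  using m1 m2 by (auto simp: attraction1_def attraction2_def lagrange_domain_eq)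

lemma crit_lagrange_iff:
  "q \<in> crit_points lagrange_domain V \<longleftrightarrow> q \<in> lagrange_domain \<and>
    attraction1 q * (q$1 + 1/2) + attraction2 q * (q$1 - 1/2) = \<epsilon> * q$1 \<and> (attraction1 q + attraction2 q - \<epsilon>) * q$2 = 0"
proof (cases "q \<in> lagrange_domain")
  case True
  define gx gy where "gx = attraction1 q * (q$1 + 1/2) + attraction2 q * (q$1 - 1/2) - \<epsilon> * q$1" and "gy = (attraction1 q + attraction2 q - \<epsilon>) * q$2"
  have D: "frechet_derivative V (at q) v = gx * v$1 + gy * v$2" for v
    unfolding frechet_derivative_lagrange_V[OF True] inner_vec2 minus_pole_nth attraction1_def[symmetric] attraction2_def[symmetric]
    by (simp add: gx_def gy_def algebra_simps)
  have "(\<forall>v :: real^2. gx * v$1 + gy * v$2 = 0) \<longleftrightarrow> gx = 0 \<and> gy = 0"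
  proof
    assume "\<forall>v :: real^2. gx * v$1 + gy * v$2 = 0"
    from this[rule_format, of "vector [1, 0]"] this[rule_format, of "vector [0, 1]"] show "gx = 0 \<and> gy = 0" by simp
  qed simp
  then show ?thesis
    unfolding crit_points_iff[OF smooth_lagrange_V True] D using True by (simp add: gx_def gy_def)
qed (simp add: crit_points_def)

text \<open>Cancelling \<open>q$2\<close> fixes the sum of the two attractions; the first equation
  then says that their difference vanishes.\<close>

lemma crit_off_axis:
  assumes "q \<in> crit_points lagrange_domain V" "q$2 \<noteq> 0"
  shows "attraction1 q = \<epsilon> / 2" "attraction2 q = \<epsilon> / 2"
proof -
  have *: "attraction1 q + attraction2 q = \<epsilon>" "attraction1 q * (q$1 + 1/2) + attraction2 q * (q$1 - 1/2) = \<epsilon> * q$1"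
    using assms by (auto simp: crit_lagrange_iff)
  have "attraction1 q * (q$1 + 1/2) + attraction2 q * (q$1 - 1/2) = (attraction1 q + attraction2 q) * q$1 + (attraction1 q - attraction2 q) / 2"
    by (simp add: field_simps)
  then show "attraction1 q = \<epsilon> / 2" "attraction2 q = \<epsilon> / 2" using * by simp_all
qed

text \<open>The isotropic part of the Hessian vanishes because the attractions add up to \<epsilon>.
  What remains are two negative rank-one terms along the directions to the poles, which are
  independent off the axis. So minus the Hessian serves as the metric.\<close>

lemma nondegenerate_off_axis:
  assumes q: "q \<in> crit_points lagrange_domain V" "q$2 \<noteq> 0"
  shows "nondegenerate_critical_point (\<lambda>v w. - hessian V q v w) lagrange_domain V q uminus"
proof -
  have dom: "q \<in> lagrange_domain" using q by (simp add: crit_lagrange_iff)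
  note bl = bilinear_hessian[OF open_lagrange_domain smooth_lagrange_V dom]
  note H = hessian_lagrange_V[OF dom, of m1 m2 \<epsilon>, folded attraction1_def attraction2_def]
  show ?thesis
  proof (intro nondegenerate_critical_point.intro inner_form.intro nondegenerate_critical_point_axioms.intro)
    show "bilinear (\<lambda>v w. - hessian V q v w)"
      using bl by (auto simp: bilinear_def intro: linear_compose_neg)
    show "- hessian V q v w = - hessian V q w v" for v w
      by (simp add: H inner_commute[of v w] mult_ac)
    show "- hessian V q v v > 0" if "v \<noteq> 0" for v
    proof -
      define c1 c2 x y where "c1 = 3 * m1 * inverse (norm (q - pole1)) ^ 5"
        and "c2 = 3 * m2 * inverse (norm (q - pole2)) ^ 5"
        and "x = (q - pole1) \<bullet> v" and "y = (q - pole2) \<bullet> v"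
      have c: "c1 > 0" "c2 > 0" using dom m1 m2 by (auto simp: c1_def c2_def lagrange_domain_eq)
      have "- hessian V q v v = c1 * (x * x) + c2 * (y * y)"
        unfolding H crit_off_axis[OF q] c1_def c2_def x_def y_def by (simp add: mult.assoc)
      moreover have "x \<noteq> 0 \<or> y \<noteq> 0"
      proof (rule ccontr)
        assume "\<not> ?thesis"
        then have z: "(q$1 + 1/2) * v$1 + q$2 * v$2 = 0" "(q$1 - 1/2) * v$1 + q$2 * v$2 = 0"
          by (simp_all add: x_def y_def inner_vec2 del: vector_minus_component)
        then have "v$1 = 0" by (simp add: algebra_simps)
        then show False using z q(2) \<open>v \<noteq> 0\<close> by (simp add: vec2_eq_iff)
      qed
      then have "c1 * (x * x) + c2 * (y * y) > 0"
        by (rule weighted_squares_pos[OF c])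
      ultimately show ?thesis by simp
    qed
    show "frechet_derivative V (at q) v = 0" for v
      using q(1) crit_points_iff[OF smooth_lagrange_V dom] by blast
    show "linear (uminus :: real^2 \<Rightarrow> real^2)" by (simp add: linear_iff)
    show "- hessian V q (- v) (- w) = - hessian V q v w" "hessian V q v w = - hessian V q (- v) w" for v w
      by (simp_all add: bilinear_lneg[OF bl] bilinear_rneg[OF bl])
  qed (use open_lagrange_domain smooth_lagrange_V dom in auto)
qed

lemma norm_on_axis:
  assumes "q$2 = 0"
  shows "norm (q - pole1) = \<bar>q$1 + 1/2\<bar>" "norm (q - pole2) = \<bar>q$1 - 1/2\<bar>"
  using assms by (simp_all add: norm_minus_pole)

text \<open>The point \<open>p\<close> off the axis lends its distances from the poles: they express
  \<open>m1\<close> and \<open>m2\<close> as \<epsilon>/2 times their cubes and satisfy the strict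
  triangle inequalities.\<close>

lemma saddle_on_axis:
  assumes q: "q \<in> crit_points lagrange_domain V" "q$2 = 0"
    and p: "p \<in> crit_points lagrange_domain V" "p$2 \<noteq> 0"
  shows "attraction1 q + attraction2 q > \<epsilon>"
proof -
  define \<rho>1 \<rho>2 s where "\<rho>1 = norm (p - pole1)" and "\<rho>2 = norm (p - pole2)" and "s = q$1 + 1/2"
  have dom: "q \<in> lagrange_domain" "p \<in> lagrange_domain" using q p by (auto simp: crit_lagrange_iff)
  have \<rho>: "\<rho>1 > 0" "\<rho>2 > 0" using dom by (auto simp: \<rho>1_def \<rho>2_def lagrange_domain_eq)
  have s: "norm (q - pole1) = \<bar>s\<bar>" "norm (q - pole2) = \<bar>s - 1\<bar>"
    using norm_on_axis[OF q(2)] by (simp_all add: s_def)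
  have s0: "s \<noteq> 0" "s \<noteq> 1" using s dom(1) by (auto simp: lagrange_domain_eq)
  have sq: "\<rho>1\<^sup>2 = (p$1 + 1/2)\<^sup>2 + (p$2)\<^sup>2" "\<rho>2\<^sup>2 = (p$1 - 1/2)\<^sup>2 + (p$2)\<^sup>2"
    unfolding \<rho>1_def \<rho>2_def norm_minus_pole by simp_all
  have gt: "\<rho>1 > \<bar>p$1 + 1/2\<bar>" "\<rho>2 > \<bar>p$1 - 1/2\<bar>"
    by (rule power_less_imp_less_base[of _ 2]; use sq p(2) \<rho> in simp)+
  have tri: "\<rho>1 + \<rho>2 > 1" using gt by linarith
  \<comment> \<open>The squares differ by \<open>2 * p$1\<close>, the sum of the horizontal offsets
    from the poles, whose absolute value is less than the sum of the distances. Dividing by that sum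
    bounds the difference of the distances by 1.\<close>
  have "(\<rho>1 - \<rho>2) * (\<rho>1 + \<rho>2) = 2 * p$1" using sq by (simp add: power2_eq_square algebra_simps)
  then have "\<bar>\<rho>1 - \<rho>2\<bar> * (\<rho>1 + \<rho>2) = \<bar>2 * p$1\<bar>" using \<rho> by (metis abs_mult abs_of_pos add_pos_pos)
  also have "\<dots> < 1 * (\<rho>1 + \<rho>2)"
    using gt abs_triangle_ineq[of "p$1 + 1/2" "p$1 - 1/2"] by simp
  finally have "\<bar>\<rho>1 - \<rho>2\<bar> < 1" using \<rho> by (simp add: mult_less_cancel_right)
  then have tri': "\<rho>1 < 1 + \<rho>2" "\<rho>2 < 1 + \<rho>1" by linarith+
  define A B where "A = (\<rho>1 / \<bar>s\<bar>) ^ 3" and "B = (\<rho>2 / \<bar>s - 1\<bar>) ^ 3"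
  have m: "m1 = \<epsilon> / 2 * \<rho>1 ^ 3" "m2 = \<epsilon> / 2 * \<rho>2 ^ 3"
  proof -
    have "m1 = attraction1 p * \<rho>1 ^ 3" "m2 = attraction2 p * \<rho>2 ^ 3"
      using \<rho> by (simp_all add: attraction1_def attraction2_def \<rho>1_def[symmetric] \<rho>2_def[symmetric] power_inverse)
    then show "m1 = \<epsilon> / 2 * \<rho>1 ^ 3" "m2 = \<epsilon> / 2 * \<rho>2 ^ 3" by (simp_all only: crit_off_axis[OF p])
  qed
  have k: "attraction1 q = \<epsilon> / 2 * A" "attraction2 q = \<epsilon> / 2 * B"
  proof -
    have "m1 * inverse \<bar>s\<bar> ^ 3 = \<epsilon> / 2 * A" "m2 * inverse \<bar>s - 1\<bar> ^ 3 = \<epsilon> / 2 * B"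
      unfolding A_def B_def power_divide by (subst m, simp only: power_inverse divide_inverse mult.assoc)+
    then show "attraction1 q = \<epsilon> / 2 * A" "attraction2 q = \<epsilon> / 2 * B" by (simp_all only: attraction1_def attraction2_def s)
  qed
  have "attraction1 q * s + attraction2 q * (s - 1) = \<epsilon> * q$1"
    using q by (simp add: crit_lagrange_iff s_def)
  moreover have "e * ((A - 1) * s + (B - 1) * (s - 1)) = e * A * s + e * B * (s - 1) - e * (2 * s - 1)" for e
    by (simp add: algebra_simps)
  moreover have "\<epsilon> * q$1 = \<epsilon> / 2 * (2 * s - 1)" by (simp add: s_def)
  ultimately have "\<epsilon> / 2 * ((A - 1) * s + (B - 1) * (s - 1)) = 0"
    unfolding k by (simp only: diff_self)
  then have "(A - 1) * s + (B - 1) * (s - 1) = 0" using \<epsilon> by simp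
  then have "A + B > 2"
    unfolding A_def B_def using triangle_imp_saddle[OF s0 \<rho> tri tri'] by simp
  then have "\<epsilon> / 2 * (A + B) > \<epsilon> / 2 * 2" using \<epsilon> by (intro mult_strict_left_mono) auto
  then show ?thesis unfolding k by (simp add: algebra_simps)
qed

text \<open>Both poles lie in the direction of the axis, so the Hessian is diagonal. The metric
  takes the absolute values of its entries and \<open>L\<close> their signs.\<close>

lemma nondegenerate_on_axis:
  assumes q: "q \<in> crit_points lagrange_domain V" "q$2 = 0" and saddle: "attraction1 q + attraction2 q > \<epsilon>"
  shows "nondegenerate_critical_point
    (\<lambda>v w. (2 * attraction1 q + 2 * attraction2 q + \<epsilon>) * v$1 * w$1 + (attraction1 q + attraction2 q - \<epsilon>) * v$2 * w$2)
    lagrange_domain V q (\<lambda>v. vector [- v$1, v$2])"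
proof -
  define a b where "a = 2 * attraction1 q + 2 * attraction2 q + \<epsilon>" and "b = attraction1 q + attraction2 q - \<epsilon>"
  have dom: "q \<in> lagrange_domain" using q by (simp add: crit_lagrange_iff)
  have ab: "a > 0" "b > 0" using attraction_pos[OF dom] \<epsilon> saddle by (auto simp: a_def b_def)
  have H: "hessian V q v w = - a * v$1 * w$1 + b * v$2 * w$2" for v w
  proof -
    define s where "s = q$1 + 1/2"
    have s: "norm (q - pole1) = \<bar>s\<bar>" "norm (q - pole2) = \<bar>s - 1\<bar>"
      using norm_on_axis[OF q(2)] by (simp_all add: s_def)
    have c: "inverse \<bar>t\<bar> ^ 5 * (t * t) = inverse \<bar>t\<bar> ^ 3" if "t \<noteq> 0" for t :: real
    proof -
      have "inverse x ^ 5 * (x * x) = inverse x ^ 3" if "x \<noteq> 0" for x :: real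
        using that by (simp add: eval_nat_numeral field_simps)
      from this[of "\<bar>t\<bar>"] that show ?thesis by (simp only: abs_mult_self_eq abs_eq_0) simp
    qed
    have s0: "s \<noteq> 0" "s - 1 \<noteq> 0" using s dom by (auto simp: lagrange_domain_eq)
    have k: "m1 * inverse \<bar>s\<bar> ^ 5 * (s * s) = attraction1 q" "m2 * inverse \<bar>s - 1\<bar> ^ 5 * ((s - 1) * (s - 1)) = attraction2 q"
      using c[OF s0(1)] c[OF s0(2)] by (simp_all add: attraction1_def attraction2_def s mult.assoc)
    have x: "(q - pole1) \<bullet> v = s * v$1" "(q - pole2) \<bullet> v = (s - 1) * v$1" for v
      unfolding inner_vec2 minus_pole_nth q(2) s_def by simp_all
    have "hessian V q v w = b * (v \<bullet> w) - 3 * (m1 * inverse \<bar>s\<bar> ^ 5 * (s * s)) * v$1 * w$1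
        - 3 * (m2 * inverse \<bar>s - 1\<bar> ^ 5 * ((s - 1) * (s - 1))) * v$1 * w$1"
      unfolding hessian_lagrange_V[OF dom, of m1 m2 \<epsilon>, folded attraction1_def attraction2_def] x s b_def by (simp add: mult_ac)
    then show ?thesis unfolding k inner_vec2 a_def b_def by (simp add: algebra_simps)
  qed
  show ?thesis
    unfolding a_def[symmetric] b_def[symmetric]
  proof (intro nondegenerate_critical_point.intro inner_form.intro nondegenerate_critical_point_axioms.intro)
    show "bilinear (\<lambda>v w :: real^2. a * v$1 * w$1 + b * v$2 * w$2)"
      by (auto simp: bilinear_def linear_iff algebra_simps)
    show "a * v$1 * w$1 + b * v$2 * w$2 = a * w$1 * v$1 + b * w$2 * v$2" for v w :: "real^2" by simp
    show "a * v$1 * v$1 + b * v$2 * v$2 > 0" if "v \<noteq> 0" for v :: "real^2"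
    proof -
      have "v$1 \<noteq> 0 \<or> v$2 \<noteq> 0" using that by (simp add: vec2_eq_iff)
      then have "a * (v$1 * v$1) + b * (v$2 * v$2) > 0" by (rule weighted_squares_pos[OF ab])
      then show ?thesis by (simp add: mult.assoc)
    qed
    show "frechet_derivative V (at q) v = 0" for v
      using q(1) crit_points_iff[OF smooth_lagrange_V dom] by blast
    show "linear (\<lambda>v :: real^2. vector [- v$1, v$2] :: real^2)" by (simp add: linear_iff vec2_eq_iff)
    show "vector [- (vector [- v$1, v$2] :: real^2)$1, (vector [- v$1, v$2] :: real^2)$2] = v" for v :: "real^2"
      by (simp add: vec2_eq_iff)
  qed (use open_lagrange_domain smooth_lagrange_V dom H in auto)
qed

lemma at_most_three_collinear:
  defines "C \<equiv> {q \<in> crit_points lagrange_domain V. q$2 = 0}"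
  shows "finite C" "card C \<le> 3"
proof -
  \<comment> \<open>Numbers the three intervals cut out by the poles; injectivity of
    \<open>c\<close> on \<open>C\<close> is then the bound. \<open>F\<close> is the derivative of
    \<open>V\<close> along the axis.\<close>
  define c where "c q = (if q$1 < -1/2 then 0 else if q$1 < 1/2 then 1 else 2 :: nat)" for q :: "real^2"
  define F where "F x = m1 * ((x + 1/2) * inverse \<bar>x + 1/2\<bar> ^ 3) + m2 * ((x - 1/2) * inverse \<bar>x - 1/2\<bar> ^ 3) - \<epsilon> * x" for x
  have F: "F (q$1) = 0" "q$1 \<noteq> -1/2" "q$1 \<noteq> 1/2" if "q \<in> C" for q
  proof -
    have q: "q \<in> crit_points lagrange_domain V" "q$2 = 0" using that by (auto simp: C_def)
    then show "F (q$1) = 0"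
      by (simp add: crit_lagrange_iff F_def attraction1_def attraction2_def norm_on_axis[OF q(2)] mult_ac)
    from q(1) have "q \<in> lagrange_domain" by (simp add: crit_lagrange_iff)
    then show "q$1 \<noteq> -1/2" "q$1 \<noteq> 1/2"
      using q(2) by (auto simp: lagrange_domain_eq vec2_eq_iff)
  qed
  have F_less: "F y < F x" if "x < y" "(x + 1/2) * (y + 1/2) > 0" "(x - 1/2) * (y - 1/2) > 0" for x y
  proof -
    have "(y + 1/2) * inverse \<bar>y + 1/2\<bar> ^ 3 < (x + 1/2) * inverse \<bar>x + 1/2\<bar> ^ 3"
      "(y - 1/2) * inverse \<bar>y - 1/2\<bar> ^ 3 < (x - 1/2) * inverse \<bar>x - 1/2\<bar> ^ 3"
      using that by (intro inverse_square_decreasing; simp)+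
    from mult_strict_left_mono[OF this(1) m1] mult_strict_left_mono[OF this(2) m2] mult_strict_left_mono[OF that(1) \<epsilon>]
    show ?thesis unfolding F_def by linarith
  qed
  have "inj_on c C"
  proof (rule inj_onI)
    fix p q assume pq: "p \<in> C" "q \<in> C" "c p = c q"
    have sign: "(p$1 + 1/2) * (q$1 + 1/2) > 0" "(p$1 - 1/2) * (q$1 - 1/2) > 0"
      using pq(3) F(2,3)[OF pq(1)] F(2,3)[OF pq(2)]
      by (auto simp: c_def zero_less_mult_iff split: if_splits)
    have "p$1 = q$1"
      using F_less[of "p$1" "q$1"] F_less[of "q$1" "p$1"] sign F(1)[OF pq(1)] F(1)[OF pq(2)]
      by (cases "p$1" "q$1" rule: linorder_cases) (auto simp: mult.commute)
    then show "p = q" using pq by (simp add: vec2_eq_iff C_def)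
  qed
  moreover have "c ` C \<subseteq> {0, 1, 2}" by (auto simp: c_def)
  ultimately show "finite C" "card C \<le> 3"
    using inj_on_finite[of c C "{0, 1, 2}"] card_inj_on_le[of c C "{0, 1, 2}"] by auto
qed

text \<open>\<open>lagrange_points\<close> does not state where \<open>l 4\<close> and
  \<open>l 5\<close> lie. On the axis, either would be a fourth collinear critical point beside
  \<open>l 1\<close>, \<open>l 2\<close>, \<open>l 3\<close>.\<close>

lemma lagrange_points_off_axis:
  assumes l: "lagrange_points m1 m2 \<epsilon> l" and i: "i \<in> {4..5}"
  shows "l i $ 2 \<noteq> 0"
proof
  assume "l i $ 2 = 0"
  then have "l ` insert i {1..3} \<subseteq> {q \<in> crit_points lagrange_domain V. q$2 = 0}"
    using l i by (auto simp: lagrange_points_def)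
  moreover have "card (l ` insert i {1..3}) = 4"
  proof -
    have "insert i {1..3} \<subseteq> {1..5}" using i by auto
    moreover have "inj_on l {1..5}" using l by (simp add: lagrange_points_def)
    ultimately have "inj_on l (insert i {1..3})" by (rule inj_on_subset[rotated])
    then have "card (l ` insert i {1..3}) = card (insert i {1..3})" by (rule card_image)
    also have "\<dots> = 4" using i by simp
    finally show ?thesis .
  qed
  ultimately have "4 \<le> card {q \<in> crit_points lagrange_domain V. q$2 = 0}"
    using card_mono[OF at_most_three_collinear(1), of "l ` insert i {1..3}"] by (simp only:)
  then show False using at_most_three_collinear(2) by linarith
qed

end

theorem theoremA:
  fixes m1 m2 \<epsilon> :: real and l :: "nat \<Rightarrow> real^2"
  assumes "m1 > 0" and "m2 > 0" and "\<epsilon> > 0"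
    and "lagrange_points m1 m2 \<epsilon> l"
  shows "(\<forall>i\<in>{1..3}. has_local_Morse_homology lagrange_domain (lagrange_V m1 m2 \<epsilon>) (l i)
            (\<lambda>k. if k = 1 then integer_mod_group 2 else singleton_group 0)) \<and>
         (\<forall>i\<in>{4..5}. has_local_Morse_homology lagrange_domain (lagrange_V m1 m2 \<epsilon>) (l i)
            (\<lambda>k. if k = 2 then integer_mod_group 2 else singleton_group 0))"
proof (intro conjI ballI)
  have crit: "l i \<in> crit_points lagrange_domain (lagrange_V m1 m2 \<epsilon>)" if "i \<in> {1..5}" for i
    using assms(4) that by (auto simp: lagrange_points_def)
  have off: "l i $ 2 \<noteq> 0" if "i \<in> {4..5}" for i
    by (rule lagrange_points_off_axis[OF assms that])
  {
    fix i :: nat assume i: "i \<in> {1..3}"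
    have q: "l i \<in> crit_points lagrange_domain (lagrange_V m1 m2 \<epsilon>)" "l i $ 2 = 0"
      using i crit assms(4) by (auto simp: lagrange_points_def)
    \<comment> \<open>\<open>l 4\<close> supplies the equilibrium off the axis that forces the
      collinear points to be saddles.\<close>
    have p: "l 4 \<in> crit_points lagrange_domain (lagrange_V m1 m2 \<epsilon>)" "l 4 $ 2 \<noteq> 0"
      using crit off by auto
    interpret nondegenerate_critical_point
      "\<lambda>v w. (2 * attraction1 m1 (l i) + 2 * attraction2 m2 (l i) + \<epsilon>) * v$1 * w$1 + (attraction1 m1 (l i) + attraction2 m2 (l i) - \<epsilon>) * v$2 * w$2"
      lagrange_domain "lagrange_V m1 m2 \<epsilon>" "l i" "\<lambda>v. vector [- v$1, v$2]"
      by (rule nondegenerate_on_axis[OF assms(1-3) q saddle_on_axis[OF assms(1-3) q p]])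
    have "{v :: real^2. vector [- v$1, v$2] = - v} = {v. v$2 = 0}" by (auto simp: vec2_eq_iff)
    then have "index = 1" unfolding index_def by (simp add: dim_first_axis)
    then show "has_local_Morse_homology lagrange_domain (lagrange_V m1 m2 \<epsilon>) (l i)
            (\<lambda>k. if k = 1 then integer_mod_group 2 else singleton_group 0)"
      using local_Morse_homology by simp
  }
  {
    fix i :: nat assume i: "i \<in> {4..5}"
    have q: "l i \<in> crit_points lagrange_domain (lagrange_V m1 m2 \<epsilon>)" using i crit by auto
    interpret nondegenerate_critical_point "\<lambda>v w. - hessian (lagrange_V m1 m2 \<epsilon>) (l i) v w"
      lagrange_domain "lagrange_V m1 m2 \<epsilon>" "l i" uminus
      by (rule nondegenerate_off_axis[OF assms(1-3) q off[OF i]])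
    have "index = 2" unfolding index_def by (simp add: dim_UNIV)
    then show "has_local_Morse_homology lagrange_domain (lagrange_V m1 m2 \<epsilon>) (l i)
            (\<lambda>k. if k = 2 then integer_mod_group 2 else singleton_group 0)"
      using local_Morse_homology by simp
  }
qed

end
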